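(* Let $L$ be a link with trivial Alexander polynomial, and let $Q$ be a finite connected solvable quandle. Then $L$ is not colorable by $Q$, i.e. every coloring of $L$ by $Q$ is trivial.
   Context: A left quasigroup is a nonempty set $Q$ with two binary operations $*,\backslash$ satisfying $x\backslash(x*y)=y=x*(x\backslash y)$; write $L_a(b)=a*b$, a permutation of $Q$. A quandle is a left quasigroup satisfying $x*(y*z)=(x*y)*(x*z)$ and $x*x=x$. $Q$ is connected if the group $\langle L_a: a\in Q\rangle$ acts transitively on $Q$. A coloring of an (oriented) link $L$ by $Q$ is an assignment $c$ of elements of $Q$ to the arcs of a diagram of $L$ such that at each crossing with over-arc $x$ and under-arcs $y,z$, where $y$ lies on the right and $z$ on the left of the oriented over-arc, $c(x)*c(y)=c(z)$. A coloring is trivial if it uses only one color; $L$ is colorable by $Q$ if there is a non-trivial coloring. The Alexander polynomial is the classical one-variable polynomial in $\mathbb{Z}[t,t^{-1}]$, defined up to units $\pm t^k$; it is trivial if it equals $1$ up to a unit. Solvability: for congruences $\alpha,\beta,\delta$ (equivalences compatible with all operations) of an algebraic structure $A$, $C(\alpha,\beta;\delta)$ means: for every $n\ge0$, every $(n+1)$-ary term operation $t$, every $a\,\alpha\,b$ and all $u_i\,\beta\,v_i$ ($i=1,\dots,n$), $t(a,u_1,\dots,u_n)\,\delta\,t(a,v_1,\dots,v_n)$ implies $t(b,u_1,\dots,u_n)\,\delta\,t(b,v_1,\dots,v_n)$. A congruence $\alpha$ is abelian if $C(\alpha,\alpha;0_A)$, where $0_A$ is equality. $A$ is solvable if there is a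 finite chain of congruences $0_A=\alpha_0\le\dots\le\alpha_n=1_A=A\times A$ such that $\alpha_{i+1}/\alpha_i$ is an abelian congruence of $A/\alpha_i$ for all $i$. For quandles, terms and congruences are taken with respect to both $*$ and $\backslash$. *)

theory Defs
  imports
    "HOL-Library.Poly_Mapping"
    "HOL-Algebra.Bij"
    "HOL-Algebra.Generated_Groups"
    "Jordan_Normal_Form.Determinant"
begin

section \<open>Quandles\<close>

record 'a left_quasigroup = "'a partial_object" +
  lmult :: "'a \<Rightarrow> 'a \<Rightarrow> 'a"
  ldiv :: "'a \<Rightarrow> 'a \<Rightarrow> 'a"

definition is_left_quasigroup :: "'a left_quasigroup \<Rightarrow> bool" where
  "is_left_quasigroup Q \<longleftrightarrow>
     carrier Q \<noteq> {} \<and>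
     (\<forall>x\<in>carrier Q. \<forall>y\<in>carrier Q.
        lmult Q x y \<in> carrier Q \<and> ldiv Q x y \<in> carrier Q \<and>
        ldiv Q x (lmult Q x y) = y \<and> lmult Q x (ldiv Q x y) = y)"

definition is_quandle :: "'a left_quasigroup \<Rightarrow> bool" where
  "is_quandle Q \<longleftrightarrow>
     is_left_quasigroup Q \<and>
     (\<forall>x\<in>carrier Q. \<forall>y\<in>carrier Q. \<forall>z\<in>carrier Q.
        lmult Q x (lmult Q y z) = lmult Q (lmult Q x y) (lmult Q x z)) \<and>
     (\<forall>x\<in>carrier Q. lmult Q x x = x)"

definition left_translation :: "'a left_quasigroup \<Rightarrow> 'a \<Rightarrow> 'a \<Rightarrow> 'a" where
  "left_translation Q a = (\<lambda>b\<in>carrier Q. lmult Q a b)"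

definition left_mult_group :: "'a left_quasigroup \<Rightarrow> ('a \<Rightarrow> 'a) set" where
  "left_mult_group Q = generate (BijGroup (carrier Q)) (left_translation Q ` carrier Q)"

definition connected_left_quasigroup :: "'a left_quasigroup \<Rightarrow> bool" where
  "connected_left_quasigroup Q \<longleftrightarrow>
     (\<forall>x\<in>carrier Q. \<forall>y\<in>carrier Q. \<exists>g\<in>left_mult_group Q. g x = y)"


section \<open>Commutator-theoretic solvability\<close>

datatype lq_term = Var nat | Mult lq_term lq_term | Div lq_term lq_term

primrec term_vars :: "lq_term \<Rightarrow> nat set" where
  "term_vars (Var i) = {i}"
| "term_vars (Mult s t) = term_vars s \<union> term_vars t"
| "term_vars (Div s t) = term_vars s \<union> term_vars t"

primrec term_op :: "'a left_quasigroup \<Rightarrow> lq_term \<Rightarrow> (nat \<Rightarrow> 'a) \<Rightarrow> 'a" where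
  "term_op A (Var i) \<rho> = \<rho> i"
| "term_op A (Mult s t) \<rho> = lmult A (term_op A s \<rho>) (term_op A t \<rho>)"
| "term_op A (Div s t) \<rho> = ldiv A (term_op A s \<rho>) (term_op A t \<rho>)"

definition congruence :: "'a left_quasigroup \<Rightarrow> 'a rel \<Rightarrow> bool" where
  "congruence A \<alpha> \<longleftrightarrow>
     equiv (carrier A) \<alpha> \<and>
     (\<forall>(x, x')\<in>\<alpha>. \<forall>(y, y')\<in>\<alpha>.
        (lmult A x y, lmult A x' y') \<in> \<alpha> \<and> (ldiv A x y, ldiv A x' y') \<in> \<alpha>)"

text \<open>
  The condition \<open>C(\<alpha>, \<beta>; \<delta>)\<close>. The assignment \<open>case_nat a u\<close> sends the variable \<open>0\<close> to \<open>a\<close>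
  and the variable \<open>Suc i\<close> to \<open>u i\<close>, so that only \<open>u 0, \<dots>, u (n - 1)\<close> matter.
\<close>

definition centralizes ::
    "'a left_quasigroup \<Rightarrow> 'a rel \<Rightarrow> 'a rel \<Rightarrow> 'a rel \<Rightarrow> bool" where
  "centralizes A \<alpha> \<beta> \<delta> \<longleftrightarrow>
     (\<forall>n t a b u v.
        term_vars t \<subseteq> {..n} \<longrightarrow> (a, b) \<in> \<alpha> \<longrightarrow> (\<forall>i<n. (u i, v i) \<in> \<beta>) \<longrightarrow>
        (term_op A t (case_nat a u), term_op A t (case_nat a v)) \<in> \<delta> \<longrightarrow>
        (term_op A t (case_nat b u), term_op A t (case_nat b v)) \<in> \<delta>)"

definition abelian_congruence :: "'a left_quasigroup \<Rightarrow> 'a rel \<Rightarrow> bool" where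
  "abelian_congruence A \<alpha> \<longleftrightarrow>
     congruence A \<alpha> \<and> centralizes A \<alpha> \<alpha> (Id_on (carrier A))"

text \<open>
  For classes \<open>X\<close> and \<open>Y\<close> of a congruence \<open>\<alpha>\<close> the operations below return the class of the
  product (left quotient) of any two representatives.
\<close>

definition quotient_algebra :: "'a left_quasigroup \<Rightarrow> 'a rel \<Rightarrow> 'a set left_quasigroup" where
  "quotient_algebra A \<alpha> =
     \<lparr>carrier = carrier A // \<alpha>,
      lmult = (\<lambda>X Y. \<Union>x\<in>X. \<Union>y\<in>Y. \<alpha> `` {lmult A x y}),
      ldiv = (\<lambda>X Y. \<Union>x\<in>X. \<Union>y\<in>Y. \<alpha> `` {ldiv A x y})\<rparr>"

definition quotient_congruence :: "'a rel \<Rightarrow> 'a rel \<Rightarrow> 'a set rel" where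
  "quotient_congruence \<beta> \<alpha> = {(\<alpha> `` {x}, \<alpha> `` {y}) | x y. (x, y) \<in> \<beta>}"

definition solvable_algebra :: "'a left_quasigroup \<Rightarrow> bool" where
  "solvable_algebra A \<longleftrightarrow>
     (\<exists>(n::nat) \<alpha>.
        \<alpha> 0 = Id_on (carrier A) \<and> \<alpha> n = carrier A \<times> carrier A \<and>
        (\<forall>i\<le>n. congruence A (\<alpha> i)) \<and>
        (\<forall>i<n. \<alpha> i \<subseteq> \<alpha> (Suc i) \<and>
           abelian_congruence (quotient_algebra A (\<alpha> i))
             (quotient_congruence (\<alpha> (Suc i)) (\<alpha> i))))"


section \<open>Oriented link diagrams\<close>

text \<open>
  An oriented link diagram is encoded by its edges (the oriented strands running from one
  crossing to the next, over or under) and its crossings. A crossing records the edges through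
  which the under-strand and the over-strand enter and leave, and its sign. An edge that meets
  no crossing is a crossingless circle of the diagram.
\<close>

datatype 'e crossing =
  Crossing (under_in: 'e) (under_out: 'e) (over_in: 'e) (over_out: 'e) (positive: bool)

record 'e diagram =
  edges :: "'e set"
  crossings :: "'e crossing set"

datatype (edge_of: 'e) half_edge = Head 'e | Tail 'e

primrec opposite :: "'e half_edge \<Rightarrow> 'e half_edge" where
  "opposite (Head e) = Tail e"
| "opposite (Tail e) = Head e"

text \<open>
  The four half-edges at a crossing in counterclockwise order. In particular the incoming
  under-edge lies on the right of the over-strand iff the crossing is positive.
\<close>

definition half_edges_at :: "'e crossing \<Rightarrow> 'e half_edge list" where
  "half_edges_at x =
     (if positive x
      then [Head (under_in x), Tail (over_out x), Tail (under_out x), Head (over_in x)]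
      else [Head (under_in x), Head (over_in x), Tail (under_out x), Tail (over_out x)])"

definition half_edges :: "'e diagram \<Rightarrow> 'e half_edge set" where
  "half_edges D = (\<Union>x\<in>crossings D. set (half_edges_at x))"

definition generated_equiv :: "'a rel \<Rightarrow> 'a rel" where
  "generated_equiv r = (r \<union> r\<inverse>)\<^sup>*"

text \<open>
  A half-edge, directed away from its crossing, stands for the left side of its edge; the
  region on that side is also on the left of the reverse of the counterclockwise next half-edge.
\<close>

definition same_region :: "'e diagram \<Rightarrow> 'e half_edge rel" where
  "same_region D = generated_equiv
     {(half_edges_at x ! i, opposite (half_edges_at x ! (Suc i mod 4))) | x i. x \<in> crossings D \<and> i < 4}"

definition same_component :: "'e diagram \<Rightarrow> 'e crossing rel" where
  "same_component D = generated_equiv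
     {(x, y). x \<in> crossings D \<and> y \<in> crossings D \<and>
        (\<exists>h\<in>set (half_edges_at x). opposite h \<in> set (half_edges_at y))}"

text \<open>
  Euler's formula \<open>V - E + F = 2 C\<close>, where \<open>C\<close> is the number of connected components of the
  underlying 4-valent graph and each component is taken with its own regions. As each component
  lies on a closed oriented surface, of Euler characteristic at most \<open>2\<close>, the formula says that
  each component is drawn on a sphere. The relative position of the components is not recorded:
  it affects neither the link nor its arcs and crossing relations.
\<close>

definition planar_diagram :: "'e diagram \<Rightarrow> bool" where
  "planar_diagram D \<longleftrightarrow>
     card (crossings D) + card (half_edges D // same_region D) =
     card {e \<in> edges D. Head e \<in> half_edges D} + 2 * card (crossings D // same_component D)"

text \<open>
  The injectivity and closure conditions say that an edge meeting a crossing leaves exactly one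
  crossing strand and enters exactly one.
\<close>

definition link_diagram :: "'e diagram \<Rightarrow> bool" where
  "link_diagram D \<longleftrightarrow>
     finite (edges D) \<and> edges D \<noteq> {} \<and>
     \<Union> (edge_of ` half_edges D) \<subseteq> edges D \<and>
     inj_on (\<lambda>(x, i). half_edges_at x ! i) (crossings D \<times> {..<4}) \<and>
     opposite ` half_edges D = half_edges D \<and>
     planar_diagram D"

text \<open>Arcs run from one undercrossing to the next, i.e.\ edges are merged along over-strands.\<close>

definition same_arc :: "'e diagram \<Rightarrow> 'e rel" where
  "same_arc D = generated_equiv {(over_in x, over_out x) | x. x \<in> crossings D}"

definition arcs :: "'e diagram \<Rightarrow> 'e set set" where
  "arcs D = edges D // same_arc D"

definition over_arc :: "'e diagram \<Rightarrow> 'e crossing \<Rightarrow> 'e set" where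
  "over_arc D x = same_arc D `` {over_in x}"

definition right_arc :: "'e diagram \<Rightarrow> 'e crossing \<Rightarrow> 'e set" where
  "right_arc D x = same_arc D `` {if positive x then under_in x else under_out x}"

definition left_arc :: "'e diagram \<Rightarrow> 'e crossing \<Rightarrow> 'e set" where
  "left_arc D x = same_arc D `` {if positive x then under_out x else under_in x}"


section \<open>Colorings\<close>

definition coloring :: "'e diagram \<Rightarrow> 'q left_quasigroup \<Rightarrow> ('e set \<Rightarrow> 'q) \<Rightarrow> bool" where
  "coloring D Q c \<longleftrightarrow>
     c ` arcs D \<subseteq> carrier Q \<and>
     (\<forall>x\<in>crossings D. lmult Q (c (over_arc D x)) (c (right_arc D x)) = c (left_arc D x))"

definition trivial_coloring :: "'e diagram \<Rightarrow> ('e set \<Rightarrow> 'q) \<Rightarrow> bool" where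
  "trivial_coloring D c \<longleftrightarrow> (\<exists>q. \<forall>a\<in>arcs D. c a = q)"

definition colorable :: "'e diagram \<Rightarrow> 'q left_quasigroup \<Rightarrow> bool" where
  "colorable D Q \<longleftrightarrow> (\<exists>c. coloring D Q c \<and> \<not> trivial_coloring D c)"


section \<open>The Alexander polynomial\<close>

text \<open>Finitely supported functions from \<open>\<int>\<close> to \<open>\<int>\<close> under convolution: the ring \<open>\<int>[t, t\<^sup>-\<^sup>1]\<close>.\<close>

type_synonym laurent = "int \<Rightarrow>\<^sub>0 int"

definition t_power :: "int \<Rightarrow> laurent" where
  "t_power k = Poly_Mapping.single k 1"

definition eq_up_to_unit :: "laurent \<Rightarrow> laurent \<Rightarrow> bool" where
  "eq_up_to_unit p q \<longleftrightarrow> (\<exists>k. p = t_power k * q \<or> p = - (t_power k * q))"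

text \<open>
  The Alexander matrix obtained by Fox calculus from the Wirtinger presentation with relations
  \<open>x y x\<^sup>-\<^sup>1 = z\<close>, for \<open>x\<close> the over-arc, \<open>y\<close> the right and \<open>z\<close> the left under-arc; every meridian is
  sent to \<open>t\<close>. The three arcs at a crossing need not be distinct, whence the sum.
\<close>

definition alexander_entry :: "'e diagram \<Rightarrow> 'e crossing \<Rightarrow> 'e set \<Rightarrow> laurent" where
  "alexander_entry D x a =
     (1 - t_power 1) * of_bool (a = over_arc D x)
     + t_power 1 * of_bool (a = right_arc D x)
     - of_bool (a = left_arc D x)"

definition alexander_minors :: "'e diagram \<Rightarrow> nat \<Rightarrow> laurent set" where
  "alexander_minors D k =
     {det (mat k k (\<lambda>(i, j). alexander_entry D (r i) (a j))) | r a.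
        inj_on r {..<k} \<and> r ` {..<k} \<subseteq> crossings D \<and>
        inj_on a {..<k} \<and> a ` {..<k} \<subseteq> arcs D}"

text \<open>
  The Alexander polynomial is the greatest common divisor of the minors of size \<open>n - 1\<close>, where
  \<open>n\<close> is the number of arcs, i.e.\ of the generators of the first elementary ideal. It is
  determined up to a unit, and it is \<open>0\<close> if there are no such minors.
\<close>

definition is_alexander_polynomial :: "'e diagram \<Rightarrow> laurent \<Rightarrow> bool" where
  "is_alexander_polynomial D \<Delta> \<longleftrightarrow>
     (\<forall>m\<in>alexander_minors D (card (arcs D) - 1). \<Delta> dvd m) \<and>
     (\<forall>d. (\<forall>m\<in>alexander_minors D (card (arcs D) - 1). d dvd m) \<longrightarrow> d dvd \<Delta>)"

end

theory Submission
  imports Defs "HOL-Algebra.Free_Abelian_Groups"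
begin

text \<open>
  The coloring is pushed down a chain of congruences that witnesses solvability: if all colors
  are congruent modulo \<open>\<alpha> (Suc i)\<close>, then they are congruent modulo \<open>\<alpha> i\<close>. Modulo \<open>\<alpha> i\<close> the colors lie
  in one block of an abelian congruence, so the whole matter is a coloring by such a block \<open>B\<close>.

  The term condition makes the displacements \<open>L_x L_y\<^sup>-\<^sup>1\<close> of \<open>B\<close> commute (\<open>abelian_block_medial\<close>). The
  displacement group then acts on each of its orbits as a regular permutation group. An orbit with a chosen point \<open>e\<close> thus
  becomes an abelian group with zero \<open>e\<close>, on which \<open>\<tau> = L_e\<close> is an automorphism and
  \<open>x * y = x + \<tau> (y - x)\<close>. Letting \<open>t\<close> act as \<open>\<tau>\<close>, the orbit is a module over \<open>\<int>[t, t\<^sup>-\<^sup>1]\<close> in which the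
  crossing relations of a coloring are the rows of the Alexander matrix. The constants are always
  solutions of these linear equations; there are no others if every difference of two basis vectors
  is a combination of the rows with Laurent polynomial coefficients
  (\<open>arc_difference_in_row_span\<close>, \<open>module_coloring_constant\<close>). That the colors do lie in one orbit is
  again such a linear statement, for the trivial action of \<open>t\<close> on \<open>\<int>\<close> and the indicator function of the
  orbit.

  What remains is to see that the rows span these differences. By the adjugate it suffices that
  one minor of size \<open>n - 1\<close> is a unit, \<open>n\<close> being the number of arcs. A priori only the greatest
  common divisor of these minors is a unit, and \<open>\<int>[t, t\<^sup>-\<^sup>1]\<close> is not a principal ideal domain. But the
  columns add up to zero, and some combination of the rows with unit coefficients vanishes
  (\<open>row_relation\<close>); hence any minor is a multiple of any other (\<open>minor_dvd_minor\<close>) and so divides the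
  Alexander polynomial.

  The relation between the rows is where planarity enters. Its coefficients are powers of \<open>t\<close> up to
  sign, the exponents being read off from an Alexander numbering: an integer for every region that
  grows by one when an edge is crossed from its right to its left. Such a numbering exists because
  first cohomology vanishes on the sphere. With Euler's formula as the definition of planarity, this
  is a counting argument: the complement of a spanning forest of the diagram is a forest in the dual
  graph (\<open>alexander_numbering\<close>).
\<close>

section \<open>Generated equivalence relations and the number of their classes\<close>

lemma equiv_generated_equiv: "equiv UNIV (generated_equiv r)"
proof (rule equivI)
  show "sym (generated_equiv r)"
    unfolding generated_equiv_def by (rule sym_rtrancl) (auto simp: sym_def)
qed (auto simp: generated_equiv_def refl_rtrancl trans_rtrancl)

lemma generated_equiv_refl [simp]: "(x, x) \<in> generated_equiv r"
  by (simp add: generated_equiv_def)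

lemma generated_equiv_sym: "(x, y) \<in> generated_equiv r \<Longrightarrow> (y, x) \<in> generated_equiv r"
  using equiv_generated_equiv[of r] by (meson equivE symD)

lemma generated_equiv_trans:
  "(x, y) \<in> generated_equiv r \<Longrightarrow> (y, z) \<in> generated_equiv r \<Longrightarrow> (x, z) \<in> generated_equiv r"
  unfolding generated_equiv_def by (rule rtrancl_trans)

lemma generated_equiv_base: "(x, y) \<in> r \<Longrightarrow> (x, y) \<in> generated_equiv r"
  by (auto simp: generated_equiv_def)

lemma generated_equiv_minimal:
  assumes "\<And>x y. (x, y) \<in> r \<Longrightarrow> (x, y) \<in> E" and "equiv UNIV E"
  shows "generated_equiv r \<subseteq> E"
proof safe
  fix x y assume "(x, y) \<in> generated_equiv r"
  hence "(x, y) \<in> (r \<union> r\<inverse>)\<^sup>*" by (simp add: generated_equiv_def)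
  thus "(x, y) \<in> E"
  proof induction
    case base
    show ?case using assms(2) by (meson UNIV_I equivE refl_onD)
  next
    case (step y z)
    hence "(y, z) \<in> E" using assms by (meson UnE converseD equivE symD)
    with step show ?case using assms(2) by (meson equivE transD)
  qed
qed

lemma generated_equiv_least:
  "r \<subseteq> generated_equiv s \<Longrightarrow> generated_equiv r \<subseteq> generated_equiv s"
  by (rule generated_equiv_minimal) (auto simp: equiv_generated_equiv)

lemma generated_equiv_mono: "r \<subseteq> s \<Longrightarrow> generated_equiv r \<subseteq> generated_equiv s"
  by (rule generated_equiv_least) (auto intro: generated_equiv_base)

lemma generated_equiv_invariant:
  assumes "(x, y) \<in> generated_equiv r" and "\<And>x y. (x, y) \<in> r \<Longrightarrow> f x = f y"
  shows "f x = f y"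
proof -
  have "generated_equiv r \<subseteq> {(x, y). f x = f y}"
    using assms(2) by (intro generated_equiv_minimal) (auto simp: equiv_def refl_on_def sym_def trans_def)
  with assms(1) show ?thesis by auto
qed

lemma generated_equiv_class_eq:
  "generated_equiv r `` {x} = generated_equiv r `` {y} \<longleftrightarrow> (x, y) \<in> generated_equiv r"
  using eq_equiv_class_iff[OF equiv_generated_equiv[of r]] by simp

text \<open>
  One more pair can only merge the classes of its two components, and everything newly related lies
  in these two.
\<close>
lemma generated_equiv_insert:
  assumes "(x, y) \<in> generated_equiv (insert (a, b) r)"
  shows "(x, y) \<in> generated_equiv r \<or>
    ((x, a) \<in> generated_equiv r \<or> (x, b) \<in> generated_equiv r) \<and>
    ((y, a) \<in> generated_equiv r \<or> (y, b) \<in> generated_equiv r)"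
proof -
  let ?R = "generated_equiv r"
  let ?M = "{x. (x, a) \<in> ?R \<or> (x, b) \<in> ?R}"
  have "generated_equiv (insert (a, b) r) \<subseteq> ?R \<union> ?M \<times> ?M"
  proof (rule generated_equiv_minimal)
    have M: "x \<in> ?M \<longleftrightarrow> y \<in> ?M" if "(x, y) \<in> ?R" for x y
      using that generated_equiv_trans generated_equiv_sym by (metis (no_types, lifting) mem_Collect_eq)
    show "equiv UNIV (?R \<union> ?M \<times> ?M)"
    proof (rule equivI)
      show "trans (?R \<union> ?M \<times> ?M)"
        unfolding trans_def using M by (auto intro: generated_equiv_trans) 
    qed (auto simp: refl_on_def sym_def intro: generated_equiv_sym)
  qed (auto intro: generated_equiv_base)
  with assms show ?thesis by auto
qed

text \<open>
  The map \<open>f\<close> induces a map from classes to classes; the last hypothesis makes it onto.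
\<close>
lemma card_quotient_le:
  assumes "finite A" and "equiv UNIV r" and "equiv UNIV s"
    and "\<And>x y. (x, y) \<in> r \<Longrightarrow> (f x, f y) \<in> s"
    and "\<And>b. b \<in> B \<Longrightarrow> \<exists>a\<in>A. (f a, b) \<in> s"
  shows "card (B // s) \<le> card (A // r)"
proof -
  have "B // s \<subseteq> (\<lambda>X. s `` (f ` X)) ` (A // r)"
  proof
    fix Y assume "Y \<in> B // s"
    then obtain b where b: "b \<in> B" "Y = s `` {b}" by (auto simp: quotient_def)
    then obtain a where a: "a \<in> A" "(f a, b) \<in> s" using assms(5) by auto
    have "s `` (f ` (r `` {a})) = s `` {f a}"
    proof
      show "s `` (f ` (r `` {a})) \<subseteq> s `` {f a}"
        using assms(3,4) by (force simp: equiv_def trans_def)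
      show "s `` {f a} \<subseteq> s `` (f ` (r `` {a}))"
        using assms(2) by (auto simp: equiv_def refl_on_def)
    qed
    also have "\<dots> = Y" using a b assms(3) by (simp add: equiv_class_eq)
    finally show "Y \<in> (\<lambda>X. s `` (f ` X)) ` (A // r)"
      using a by (auto simp: quotient_def)
  qed
  moreover have "finite (A // r)" using assms(1) by (auto simp: quotient_def)
  ultimately show ?thesis by (meson card_image_le card_mono finite_imageI le_trans)
qed

text \<open>
  Away from the class of \<open>b\<close>, distinct classes stay distinct when \<open>a\<close> and \<open>b\<close> are identified.
\<close>
lemma card_quotient_insert:
  assumes "finite A"
  shows "card (A // generated_equiv r) \<le> Suc (card (A // generated_equiv (insert (a, b) r)))"
proof -
  let ?R = "generated_equiv r" and ?Q = "generated_equiv (insert (a, b) r)"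
  have fin: "finite (A // s)" for s using assms by (auto simp: quotient_def)
  have "inj_on (\<lambda>X. ?Q `` X) (A // ?R - {?R `` {b}})"
  proof (rule inj_onI)
    fix X Y assume X: "X \<in> A // ?R - {?R `` {b}}" and Y: "Y \<in> A // ?R - {?R `` {b}}"
      and eq: "?Q `` X = ?Q `` Y"
    from X obtain x where x: "X = ?R `` {x}" "(x, b) \<notin> ?R"
      unfolding quotient_def generated_equiv_class_eq[symmetric] by blast
    from Y obtain y where y: "Y = ?R `` {y}" "(y, b) \<notin> ?R"
      unfolding quotient_def generated_equiv_class_eq[symmetric] by blast
    have RQ: "?R \<subseteq> ?Q" by (rule generated_equiv_mono) auto
    have cl: "?Q `` (?R `` {z}) = ?Q `` {z}" for z
      using RQ by (auto intro: generated_equiv_trans generated_equiv_refl)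
    from eq have "(x, y) \<in> ?Q" by (simp add: x y cl generated_equiv_class_eq)
    hence "(x, y) \<in> ?R"
      using generated_equiv_insert x(2) y(2) generated_equiv_sym generated_equiv_trans by metis
    thus "X = Y" by (simp add: x y generated_equiv_class_eq)
  qed
  moreover have "(\<lambda>X. ?Q `` X) ` (A // ?R - {?R `` {b}}) \<subseteq> A // ?Q"
  proof (rule image_subsetI)
    fix X assume "X \<in> A // ?R - {?R `` {b}}"
    then obtain x where x: "x \<in> A" "X = ?R `` {x}" unfolding quotient_def by blast
    have RQ: "?R \<subseteq> ?Q" by (rule generated_equiv_mono) auto
    have "?Q `` X = ?Q `` {x}"
      unfolding x using RQ by (auto intro: generated_equiv_trans generated_equiv_refl)
    thus "?Q `` X \<in> A // ?Q" using x by (auto simp: quotient_def)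
  qed
  ultimately have "card (A // ?R - {?R `` {b}}) \<le> card (A // ?Q)"
    using fin by (rule card_inj_on_le)
  moreover have "card (A // ?R) \<le> Suc (card (A // ?R - {?R `` {b}}))"
    by (subst card_Diff_singleton_if) auto
  ultimately show ?thesis by linarith
qed

section \<open>Forests, potentials and flows\<close>

text \<open>
  Connectedness in a graph with vertices identified along \<open>R\<close>. The base relation allows the vertices
  of the dual graph to be represented by half-edges instead of regions.
\<close>
definition joined :: "'v rel \<Rightarrow> ('e \<Rightarrow> 'v) \<Rightarrow> ('e \<Rightarrow> 'v) \<Rightarrow> 'e set \<Rightarrow> 'v rel" where
  "joined R s t S = generated_equiv (R \<union> (\<lambda>e. (s e, t e)) ` S)"

inductive forest :: "'v rel \<Rightarrow> ('e \<Rightarrow> 'v) \<Rightarrow> ('e \<Rightarrow> 'v) \<Rightarrow> 'e set \<Rightarrow> bool"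
  for R s t where
  empty: "forest R s t {}"
| insert: "forest R s t S \<Longrightarrow> e \<notin> S \<Longrightarrow> (s e, t e) \<notin> joined R s t S \<Longrightarrow> forest R s t (insert e S)"

lemma joined_refl [simp]: "(x, x) \<in> joined R s t S"
  by (simp add: joined_def)

lemma joined_sym: "(x, y) \<in> joined R s t S \<Longrightarrow> (y, x) \<in> joined R s t S"
  unfolding joined_def by (rule generated_equiv_sym)

lemma joined_trans:
  "(x, y) \<in> joined R s t S \<Longrightarrow> (y, z) \<in> joined R s t S \<Longrightarrow> (x, z) \<in> joined R s t S"
  unfolding joined_def by (rule generated_equiv_trans)

lemma joined_base: "(x, y) \<in> R \<Longrightarrow> (x, y) \<in> joined R s t S"
  unfolding joined_def by (rule generated_equiv_base) auto

lemma equiv_joined: "equiv UNIV (joined R s t S)"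
  unfolding joined_def by (rule equiv_generated_equiv)

lemma joined_insert: "joined R s t (insert e S) = generated_equiv (insert (s e, t e) (R \<union> (\<lambda>e. (s e, t e)) ` S))"
  by (simp add: joined_def)

lemma joined_mono: "S \<subseteq> S' \<Longrightarrow> joined R s t S \<subseteq> joined R s t S'"
  unfolding joined_def by (rule generated_equiv_mono) auto

lemma joined_edge: "e \<in> S \<Longrightarrow> (s e, t e) \<in> joined R s t S"
  unfolding joined_def by (rule generated_equiv_base) auto

lemma joined_least:
  assumes "\<And>e. e \<in> S' \<Longrightarrow> (s e, t e) \<in> joined R s t S"
  shows "joined R s t S' \<subseteq> joined R s t S"
  unfolding joined_def
proof (rule generated_equiv_least, safe)
  fix x y assume "(x, y) \<in> R"
  thus "(x, y) \<in> generated_equiv (R \<union> (\<lambda>e. (s e, t e)) ` S)" by (intro generated_equiv_base) auto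
next
  fix e assume "e \<in> S'"
  thus "(s e, t e) \<in> generated_equiv (R \<union> (\<lambda>e. (s e, t e)) ` S)"
    using assms unfolding joined_def by blast
qed

text \<open>
  Each edge lowers the number of components by at most one.
\<close>
lemma card_quotient_joined:
  assumes "finite V" "finite S"
  shows "card (V // generated_equiv R) \<le> card (V // joined R s t S) + card S"
  using assms(2)
proof induction
  case empty
  show ?case by (simp add: joined_def)
next
  case (insert e S)
  have "card (V // joined R s t S) \<le> Suc (card (V // joined R s t (insert e S)))"
    unfolding joined_insert unfolding joined_def by (rule card_quotient_insert[OF assms(1)])
  with insert show ?case by simp
qed

text \<open>
  Edges are added one at a time, skipping those whose endpoints are already connected.
\<close>
lemma spanning_forest:
  assumes "finite E"
  obtains T where "T \<subseteq> E" "forest R s t T" "joined R s t T = joined R s t E"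
proof -
  have "\<exists>T\<subseteq>E. forest R s t T \<and> joined R s t T = joined R s t E"
    using assms
  proof induction
    case empty
    show ?case by (auto intro: forest.empty)
  next
    case (insert e E)
    then obtain T where T: "T \<subseteq> E" "forest R s t T" "joined R s t T = joined R s t E" by auto
    show ?case
    proof (cases "(s e, t e) \<in> joined R s t T")
      case True
      have "joined R s t (insert e E) \<subseteq> joined R s t T"
        using True T(3) joined_edge[of _ E s t R] by (intro joined_least) auto
      moreover have "joined R s t T \<subseteq> joined R s t (insert e E)" using T by (intro joined_mono) auto
      ultimately show ?thesis using T by blast
    next
      case False
      have f: "forest R s t (insert e T)" using T False insert by (intro forest.insert) auto
      have "joined R s t (insert e E) \<subseteq> joined R s t (insert e T)"
      proof (rule joined_least)
        fix d assume "d \<in> insert e E"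
        thus "(s d, t d) \<in> joined R s t (insert e T)"
        proof
          assume "d \<in> E"
          hence "(s d, t d) \<in> joined R s t T" using T(3) joined_edge by metis
          thus ?thesis using joined_mono[of T "insert e T"] by blast
        qed (simp add: joined_edge)
      qed
      moreover have "joined R s t (insert e T) \<subseteq> joined R s t (insert e E)"
        using T by (intro joined_mono) auto
      ultimately show ?thesis using f T by blast
    qed
  qed
  thus ?thesis using that by blast
qed

text \<open>
  In a forest any prescribed differences along the edges are realized by a function on the
  vertices: a new edge joins two components, one of which can be shifted by a constant.
\<close>
lemma forest_potential:
  assumes "forest R s t S"
  obtains g :: "'v \<Rightarrow> int" where "\<And>x y. (x, y) \<in> R \<Longrightarrow> g x = g y"
    "\<And>e. e \<in> S \<Longrightarrow> g (t e) - g (s e) = a e"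
proof -
  have "\<exists>g::'v \<Rightarrow> int. (\<forall>(x, y)\<in>R. g x = g y) \<and> (\<forall>e\<in>S. g (t e) - g (s e) = a e)"
    using assms
  proof induction
    case empty
    show ?case by (auto intro: exI[of _ "\<lambda>_. 0"])
  next
    case (insert S e)
    then obtain g :: "'v \<Rightarrow> int" where g: "\<And>x y. (x, y) \<in> R \<Longrightarrow> g x = g y"
       "\<And>e. e \<in> S \<Longrightarrow> g (t e) - g (s e) = a e" by auto
    let ?J = "joined R s t S"
    define h where "h x = g x + (if (t e, x) \<in> ?J then a e - (g (t e) - g (s e)) else 0)" for x
    have J: "(t e, x) \<in> ?J \<longleftrightarrow> (t e, y) \<in> ?J" if "(x, y) \<in> R \<union> (\<lambda>e. (s e, t e)) ` S" for x y
    proof -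
      have "(x, y) \<in> ?J" unfolding joined_def by (rule generated_equiv_base[OF that])
      thus ?thesis unfolding joined_def by (meson generated_equiv_sym generated_equiv_trans)
    qed
    have "h x = h y" if "(x, y) \<in> R" for x y using J[of x y] g(1)[OF that] that by (simp add: h_def)
    moreover have "h (t d) - h (s d) = a d" if "d \<in> S" for d
      using J[of "s d" "t d"] g(2)[OF that] that by (simp add: h_def)
    moreover have "h (t e) - h (s e) = a e"
    proof -
      have "(t e, s e) \<notin> ?J" using insert(3) unfolding joined_def by (meson generated_equiv_sym)
      moreover have "(t e, t e) \<in> ?J" by (simp add: joined_def)
      ultimately show ?thesis by (simp add: h_def)
    qed
    ultimately show ?case by (intro exI[of _ h]) auto
  qed
  thus ?thesis using that by blast
qed

section \<open>Alexander numbering of a planar diagram\<close>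

primrec the_edge :: "'e half_edge \<Rightarrow> 'e" where
  "the_edge (Head e) = e"
| "the_edge (Tail e) = e"

locale link =
  fixes D :: "'e diagram"
  assumes link_diagram: "link_diagram D"
begin

definition half_edge_sign :: "'e half_edge \<Rightarrow> int" where
  "half_edge_sign h = (case h of Head e \<Rightarrow> 1 | Tail e \<Rightarrow> -1)"

lemma half_edges_at_cases:
  "half_edges_at x = [Head (under_in x), Tail (over_out x), Tail (under_out x), Head (over_in x)] \<and> positive x \<or>
   half_edges_at x = [Head (under_in x), Head (over_in x), Tail (under_out x), Tail (over_out x)] \<and> \<not> positive x"
  by (simp add: half_edges_at_def)

lemma length_half_edges_at [simp]: "length (half_edges_at x) = 4"
  using half_edges_at_cases[of x] by auto

lemma set_half_edges_at: "set (half_edges_at x) = (!) (half_edges_at x) ` {..<4}"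
  by (simp add: set_conv_nth image_def lessThan_def) blast

lemma half_edges_eq_image: "half_edges D = (\<lambda>(x, i). half_edges_at x ! i) ` (crossings D \<times> {..<4})"
  unfolding half_edges_def set_half_edges_at by force

lemma inj_half_edges: "inj_on (\<lambda>(x, i). half_edges_at x ! i) (crossings D \<times> {..<4})"
  using link_diagram by (simp add: link_diagram_def)

lemma finite_edges: "finite (edges D)"
  using link_diagram by (simp add: link_diagram_def)

lemma the_edge_in_edges: "h \<in> half_edges D \<Longrightarrow> the_edge h \<in> edges D"
  using link_diagram by (cases h) (fastforce simp: link_diagram_def)+

lemma opposite_opposite [simp]: "opposite (opposite h) = h"
  by (cases h) auto

lemma opposite_half_edges [simp]: "opposite h \<in> half_edges D \<longleftrightarrow> h \<in> half_edges D"
proof -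
  have "opposite ` half_edges D = half_edges D" using link_diagram by (simp add: link_diagram_def)
  thus ?thesis by (metis imageI opposite_opposite)
qed

lemma Tail_half_edge_iff: "Tail e \<in> half_edges D \<longleftrightarrow> Head e \<in> half_edges D"
  using opposite_half_edges[of "Head e"] by simp

text \<open>
  The edges of the underlying 4-valent graph, that is, all edges but the crossingless circles.
\<close>
definition joints :: "'e set" where
  "joints = {e \<in> edges D. Head e \<in> half_edges D}"

lemma joints_iff: "e \<in> joints \<longleftrightarrow> Head e \<in> half_edges D"
  using the_edge_in_edges[of "Head e"] by (auto simp: joints_def)

lemma finite_joints: "finite joints"
  using finite_edges by (simp add: joints_def)

lemma half_edges_eq_joints: "half_edges D = Head ` joints \<union> Tail ` joints"
proof (rule Set.set_eqI)
  fix h :: "'e half_edge" show "h \<in> half_edges D \<longleftrightarrow> h \<in> Head ` joints \<union> Tail ` joints"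
    by (cases h) (auto simp: joints_iff Tail_half_edge_iff image_iff)
qed

lemma finite_half_edges: "finite (half_edges D)"
  using finite_joints by (simp add: half_edges_eq_joints)

lemma finite_crossings: "finite (crossings D)"
proof -
  have "finite (crossings D \<times> {..<4::nat})"
    using finite_half_edges inj_half_edges unfolding half_edges_eq_image by (rule finite_imageD)
  thus ?thesis by (rule finite_cartesian_productD1) (auto simp: lessThan_empty_iff)
qed

lemma sum_half_edges:
  "(\<Sum>h\<in>half_edges D. f h) = (\<Sum>x\<in>crossings D. \<Sum>i<4. f (half_edges_at x ! i))"
  unfolding half_edges_eq_image sum.reindex[OF inj_half_edges] sum.cartesian_product
  by (simp add: case_prod_unfold)

lemma sum_joints:
  "(\<Sum>h\<in>half_edges D. f h) = (\<Sum>e\<in>joints. f (Head e) + f (Tail e))"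
proof -
  have "(\<Sum>h\<in>half_edges D. f h) = (\<Sum>h\<in>Head ` joints. f h) + (\<Sum>h\<in>Tail ` joints. f h)"
    unfolding half_edges_eq_joints using finite_joints by (intro sum.union_disjoint) auto
  also have "\<dots> = (\<Sum>e\<in>joints. f (Head e)) + (\<Sum>e\<in>joints. f (Tail e))"
    by (simp add: sum.reindex inj_on_def)
  finally show ?thesis by (simp add: sum.distrib)
qed

definition vertex :: "'e half_edge \<Rightarrow> 'e crossing" where
  "vertex h = (THE x. x \<in> crossings D \<and> h \<in> set (half_edges_at x))"

lemma vertex_eq:
  assumes "x \<in> crossings D" "h \<in> set (half_edges_at x)"
  shows "vertex h = x"
  unfolding vertex_def
proof (rule the_equality)
  fix y assume y: "y \<in> crossings D \<and> h \<in> set (half_edges_at y)"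
  from assms(2) obtain i where i: "i < 4" "h = half_edges_at x ! i"
    unfolding set_half_edges_at by auto
  from y obtain j where j: "j < 4" "h = half_edges_at y ! j"
    unfolding set_half_edges_at by auto
  have "(y, j) = (x, i)"
    by (rule inj_onD[OF inj_half_edges]) (use assms(1) y i j in simp_all)
  thus "y = x" by simp
qed (simp add: assms)

lemma vertex_nth: "x \<in> crossings D \<Longrightarrow> i < 4 \<Longrightarrow> vertex (half_edges_at x ! i) = x"
  by (rule vertex_eq) auto

text \<open>
  A flow supported on a forest vanishes. Pairing the flow with a function \<open>g\<close> on the crossings gives
  zero by conservation at each crossing, and it gives the flow through the edge \<open>e\<close> if \<open>g\<close> is a
  potential with difference 1 along \<open>e\<close> and 0 along the other edges of the forest.
\<close>
lemma flow_on_forest_zero: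
  fixes w :: "'e \<Rightarrow> int"
  assumes forest: "forest {} (\<lambda>e. vertex (Tail e)) (\<lambda>e. vertex (Head e)) T" and "T \<subseteq> joints"
    and zero: "\<And>e. e \<in> joints - T \<Longrightarrow> w e = 0"
    and flow: "\<And>x. x \<in> crossings D \<Longrightarrow>
      (\<Sum>i<4. half_edge_sign (half_edges_at x ! i) * w (the_edge (half_edges_at x ! i))) = 0"
    and "e \<in> joints"
  shows "w e = 0"
proof (cases "e \<in> T")
  case True
  from forest_potential[OF forest, where a = "\<lambda>d. of_bool (d = e)"]
  obtain g :: "'e crossing \<Rightarrow> int"
    where g: "\<And>d. d \<in> T \<Longrightarrow> g (vertex (Head d)) - g (vertex (Tail d)) = of_bool (d = e)"
    by auto
  let ?f = "\<lambda>h. g (vertex h) * (half_edge_sign h * w (the_edge h))"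
  have "0 = (\<Sum>x\<in>crossings D. g x * (\<Sum>i<4. half_edge_sign (half_edges_at x ! i) * w (the_edge (half_edges_at x ! i))))"
    using flow by simp
  also have "\<dots> = (\<Sum>h\<in>half_edges D. ?f h)"
    unfolding sum_half_edges sum_distrib_left by (intro sum.cong refl) (simp add: vertex_nth)
  also have "\<dots> = (\<Sum>d\<in>joints. (g (vertex (Head d)) - g (vertex (Tail d))) * w d)"
    unfolding sum_joints by (simp add: half_edge_sign_def algebra_simps)
  also have "\<dots> = (\<Sum>d\<in>joints. if d = e then w d else 0)"
    using zero g by (intro sum.cong refl) (case_tac "x \<in> T", auto)
  also have "\<dots> = w e" using assms(5) finite_joints by simp
  finally show ?thesis by simp
next
  case False
  with assms(5) show ?thesis by (intro zero) simp
qed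

text \<open>
  The pairs that generate the relation of lying on the same region, one for each of the four corners
  at a crossing.
\<close>
definition sectors :: "'e half_edge rel" where
  "sectors = {(half_edges_at x ! i, opposite (half_edges_at x ! (Suc i mod 4))) | x i. x \<in> crossings D \<and> i < 4}"

lemma sectorsI:
  "x \<in> crossings D \<Longrightarrow> i < 4 \<Longrightarrow>
    (half_edges_at x ! i, opposite (half_edges_at x ! (Suc i mod 4))) \<in> sectors"
  unfolding sectors_def by blast

lemma same_region_eq: "same_region D = generated_equiv sectors"
  by (simp add: same_region_def sectors_def)

lemma sum_lessThan_4: "(\<Sum>i<4. f i) = f 0 + f 1 + f 2 + f (3::nat)"
  by (simp add: eval_nat_numeral)

text \<open>
  The differences of a function on the regions across the edges form a flow: around a crossing they
  telescope.
\<close>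
lemma coboundary_flow:
  fixes f :: "'e half_edge \<Rightarrow> int"
  assumes f: "\<And>h k. (h, k) \<in> sectors \<Longrightarrow> f h = f k" and x: "x \<in> crossings D"
    and w: "\<And>e. w e = f (Tail e) - f (Head e)"
  shows "(\<Sum>i<4. half_edge_sign (half_edges_at x ! i) * w (the_edge (half_edges_at x ! i))) = 0"
proof -
  have sw: "half_edge_sign h * w (the_edge h) = f (opposite h) - f h" for h
    by (cases h) (auto simp: half_edge_sign_def w)
  have step: "f (opposite (half_edges_at x ! (Suc i mod 4))) = f (half_edges_at x ! i)" if "i < 4" for i
    using f[OF sectorsI[OF x that]] by (rule sym)
  have mod: "Suc 0 mod 4 = 1" "Suc 1 mod 4 = 2" "Suc 2 mod 4 = 3" "Suc 3 mod 4 = 0" by simp_all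
  have "f (opposite (half_edges_at x ! 1)) = f (half_edges_at x ! 0)"
    "f (opposite (half_edges_at x ! 2)) = f (half_edges_at x ! 1)"
    "f (opposite (half_edges_at x ! 3)) = f (half_edges_at x ! 2)"
    "f (opposite (half_edges_at x ! 0)) = f (half_edges_at x ! 3)"
    using step[of 0] step[of 1] step[of 2] step[of 3] unfolding mod by (simp_all only: zero_less_numeral one_less_numeral_iff numeral_less_iff semiring_norm simp_thms)
  thus ?thesis unfolding sw sum_lessThan_4 by linarith
qed

lemma euler: "card (crossings D) + card (half_edges D // same_region D) =
     card joints + 2 * card (crossings D // same_component D)"
  using link_diagram by (simp add: link_diagram_def planar_diagram_def joints_def)

text \<open>
  Let \<open>T\<close> be a spanning forest of the diagram. The remaining edges still connect all regions that the
  edges connect: the indicator function of a component has differences supported on \<open>T\<close>, and these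
  are zero as a flow on a forest. By Euler's formula the remaining edges are then no more than a
  spanning forest of the dual graph has, so they form one. Hence there is a function \<open>f\<close> with
  difference 1 across all of them. As the constant 1 is a flow too, so is the deviation of the
  differences of \<open>f\<close> from 1, and being supported on \<open>T\<close> it vanishes.
\<close>
theorem alexander_numbering:
  obtains f :: "'e half_edge \<Rightarrow> int"
  where "\<And>h k. (h, k) \<in> sectors \<Longrightarrow> f h = f k"
    and "\<And>e. e \<in> joints \<Longrightarrow> f (Tail e) = f (Head e) + 1"
proof -
  let ?s = "\<lambda>e. vertex (Tail e)" and ?t = "\<lambda>e. vertex (Head e)"
  let ?C = "card (crossings D // same_component D)"
  obtain T where T: "T \<subseteq> joints" "forest {} ?s ?t T" "joined {} ?s ?t T = joined {} ?s ?t joints"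
    using spanning_forest[OF finite_joints] by blast
  have finT: "finite T" using T(1) finite_joints finite_subset by auto
  have "card (crossings D) \<le> ?C + card T"
  proof -
    have "generated_equiv {} = (Id :: 'e crossing rel)" by (simp add: generated_equiv_def)
    hence "card (crossings D) = card (crossings D // generated_equiv {})"
      by (simp add: quotient_def UNION_singleton_eq_range card_image)
    also have "\<dots> \<le> card (crossings D // joined {} ?s ?t T) + card T"
      using finite_crossings finT by (rule card_quotient_joined)
    also have "card (crossings D // joined {} ?s ?t T) \<le> ?C"
    proof (rule card_quotient_le[where f = "\<lambda>x. x"])
      have "same_component D \<subseteq> joined {} ?s ?t joints"
        unfolding same_component_def joined_def
      proof (rule generated_equiv_least, safe)
        fix x y h assume xy: "x \<in> crossings D" "y \<in> crossings D"
          and h: "h \<in> set (half_edges_at x)" "opposite h \<in> set (half_edges_at y)"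
        have hD: "h \<in> half_edges D" using xy h by (auto simp: half_edges_def)
        have v: "vertex h = x" "vertex (opposite h) = y" using xy h by (auto intro: vertex_eq)
        let ?e = "the_edge h"
        have "?e \<in> joints" using hD by (cases h) (auto simp: joints_iff Tail_half_edge_iff)
        hence "(?s ?e, ?t ?e) \<in> generated_equiv ({} \<union> (\<lambda>e. (?s e, ?t e)) ` joints)"
          by (intro generated_equiv_base) auto
        thus "(x, y) \<in> generated_equiv ({} \<union> (\<lambda>e. (?s e, ?t e)) ` joints)"
          using v by (cases h) (auto intro: generated_equiv_sym)
      qed
      thus "(x, y) \<in> joined {} ?s ?t T" if "(x, y) \<in> same_component D" for x y
        using that T(3) by auto
      show "\<exists>a\<in>crossings D. (a, b) \<in> joined {} ?s ?t T" if "b \<in> crossings D" for b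
        using that by (blast intro: joined_refl)
      show "finite (crossings D)" by (rule finite_crossings)
      show "equiv UNIV (same_component D)" unfolding same_component_def by (rule equiv_generated_equiv)
      show "equiv UNIV (joined {} ?s ?t T)" by (rule equiv_joined)
    qed
    finally show ?thesis by simp
  qed
  moreover have "card (joints - T) = card joints - card T"
    using T(1) finT by (simp add: card_Diff_subset)
  moreover have "card T \<le> card joints" using T(1) finite_joints by (simp add: card_mono)
  ultimately have S_le: "card (joints - T) + ?C \<le> card (half_edges D // same_region D)"
    using euler by linarith
  let ?J = "joined sectors Head Tail"
  obtain S where S: "S \<subseteq> joints - T" "forest sectors Head Tail S" "?J S = ?J (joints - T)"
    using spanning_forest[of "joints - T" sectors Head Tail] finite_joints by blast
  have finS: "finite S" using S(1) finite_joints finite_subset by auto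
  \<comment> \<open>The edges outside \<open>T\<close> connect the same regions as all edges.\<close>
  have sub: "joined sectors Head Tail joints \<subseteq> ?J S"
  proof (rule joined_least)
    fix e assume e: "e \<in> joints"
    define f :: "'e half_edge \<Rightarrow> int" where "f h = of_bool ((Head e, h) \<in> ?J S)" for h
    have inv: "f h = f k" if "(h, k) \<in> ?J S" for h k
    proof -
      have "(Head e, h) \<in> ?J S \<longleftrightarrow> (Head e, k) \<in> ?J S"
        using that by (blast intro: joined_sym joined_trans)
      thus ?thesis by (simp add: f_def)
    qed
    have sec: "f h = f k" if "(h, k) \<in> sectors" for h k
      using that by (intro inv) (auto intro: joined_base)
    have "f (Tail e) - f (Head e) = 0"
    proof (rule flow_on_forest_zero[OF T(2,1) _ _ e])
      show "f (Tail d) - f (Head d) = 0" if "d \<in> joints - T" for d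
        using inv[of "Head d" "Tail d"] joined_edge[OF that, of Head Tail sectors] S(3) by simp
    next
      fix x assume "x \<in> crossings D"
      thus "(\<Sum>i<4. half_edge_sign (half_edges_at x ! i) * (f (Tail (the_edge (half_edges_at x ! i)))
          - f (Head (the_edge (half_edges_at x ! i))))) = 0"
        using coboundary_flow[of f x "\<lambda>e. f (Tail e) - f (Head e)", OF sec] by simp
    qed
    moreover have "f (Head e) = 1" by (simp add: f_def)
    ultimately show "(Head e, Tail e) \<in> ?J S" unfolding f_def by (cases "(Head e, Tail e) \<in> ?J S") auto
  qed
  \<comment> \<open>Regions meeting the same component of the diagram are connected in the dual graph.\<close>
  have "card (half_edges D // ?J S) \<le> ?C"
  proof (rule card_quotient_le[where f = "\<lambda>x. half_edges_at x ! 0"])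
    let ?Q = "joined sectors Head Tail joints"
    have opp: "(h, opposite h) \<in> ?Q" if "h \<in> half_edges D" for h
      using that joined_edge[of _ joints Head Tail sectors]
      by (cases h) (auto simp: joints_iff Tail_half_edge_iff intro: joined_sym)
    have at: "(half_edges_at x ! 0, h) \<in> ?Q" if "x \<in> crossings D" "h \<in> set (half_edges_at x)" for x h
    proof -
      have next_h: "(half_edges_at x ! i, half_edges_at x ! Suc i) \<in> ?Q" if "Suc i < 4" for i
      proof -
        have "(half_edges_at x ! i, opposite (half_edges_at x ! Suc i)) \<in> sectors"
          using sectorsI[OF \<open>x \<in> crossings D\<close>, of i] that by simp
        hence "(half_edges_at x ! i, opposite (half_edges_at x ! Suc i)) \<in> ?Q"
          by (auto intro: joined_base)
        moreover have "half_edges_at x ! Suc i \<in> half_edges D"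
          using that \<open>x \<in> crossings D\<close> nth_mem[of "Suc i" "half_edges_at x"]
          unfolding half_edges_def length_half_edges_at by blast
        hence "(opposite (half_edges_at x ! Suc i), half_edges_at x ! Suc i) \<in> ?Q"
          using opp[of "half_edges_at x ! Suc i"] by (blast intro: joined_sym)
        ultimately show ?thesis by (blast intro: joined_trans)
      qed
      have "i < 4 \<Longrightarrow> (half_edges_at x ! 0, half_edges_at x ! i) \<in> ?Q" for i
      proof (induction i)
        case (Suc i)
        thus ?case using joined_trans[OF _ next_h[of i]] by simp
      qed simp
      with that show ?thesis unfolding set_half_edges_at by auto
    qed
    have "same_component D \<subseteq> {(x, y). (half_edges_at x ! 0, half_edges_at y ! 0) \<in> ?Q}"
      unfolding same_component_def
    proof (rule generated_equiv_minimal, goal_cases)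
      case (1 x y)
      then obtain h where xy: "x \<in> crossings D" "y \<in> crossings D"
        and h: "h \<in> set (half_edges_at x)" "opposite h \<in> set (half_edges_at y)" by auto
      have "h \<in> half_edges D" using xy h by (auto simp: half_edges_def)
      hence "(half_edges_at x ! 0, opposite h) \<in> ?Q"
        using joined_trans[OF at[OF xy(1) h(1)] opp[of h]] by simp
      from joined_trans[OF this joined_sym[OF at[OF xy(2) h(2)]]] show ?case by simp
    next
      case 2
      show ?case
      proof (rule equivI)
        show "refl {(x, y). (half_edges_at x ! 0, half_edges_at y ! 0) \<in> ?Q}"
          unfolding refl_on_def by simp
        show "sym {(x, y). (half_edges_at x ! 0, half_edges_at y ! 0) \<in> ?Q}"
          unfolding sym_def by (blast intro: joined_sym)
        show "trans {(x, y). (half_edges_at x ! 0, half_edges_at y ! 0) \<in> ?Q}"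
          unfolding trans_def by (blast intro: joined_trans)
      qed simp
    qed
    thus "(half_edges_at x ! 0, half_edges_at y ! 0) \<in> ?J S" if "(x, y) \<in> same_component D" for x y
      using that sub by auto
    show "\<exists>a\<in>crossings D. (half_edges_at a ! 0, h) \<in> ?J S" if "h \<in> half_edges D" for h
      using that at sub unfolding half_edges_def by blast
    show "finite (crossings D)" by (rule finite_crossings)
    show "equiv UNIV (same_component D)" unfolding same_component_def by (rule equiv_generated_equiv)
    show "equiv UNIV (?J S)" by (rule equiv_joined)
  qed
  moreover have "card (half_edges D // same_region D) \<le> card (half_edges D // ?J S) + card S"
    unfolding same_region_eq using finite_half_edges finS by (rule card_quotient_joined)
  ultimately have "card (joints - T) \<le> card S" using S_le by linarith
  hence S_eq: "S = joints - T" using S(1) finite_joints by (meson card_seteq finite_Diff)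
  obtain f :: "'e half_edge \<Rightarrow> int" where f: "\<And>h k. (h, k) \<in> sectors \<Longrightarrow> f h = f k"
    "\<And>e. e \<in> S \<Longrightarrow> f (Tail e) - f (Head e) = 1"
    using forest_potential[OF S(2), where a = "\<lambda>_. 1"] by blast
  have "f (Tail e) - f (Head e) - 1 = 0" if "e \<in> joints" for e
  proof (rule flow_on_forest_zero[OF T(2,1) _ _ that])
    fix x assume x: "x \<in> crossings D"
    have "(\<Sum>i<4. half_edge_sign (half_edges_at x ! i)) = 0"
      using half_edges_at_cases[of x] by (auto simp: sum_lessThan_4 half_edge_sign_def eval_nat_numeral)
    with coboundary_flow[OF f(1) x refl]
    show "(\<Sum>i<4. half_edge_sign (half_edges_at x ! i) *
        (f (Tail (the_edge (half_edges_at x ! i))) - f (Head (the_edge (half_edges_at x ! i))) - 1)) = 0"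
      by (simp add: right_diff_distrib sum_subtractf)
  next
    fix d assume "d \<in> joints - T"
    thus "f (Tail d) - f (Head d) - 1 = 0" using f(2)[of d] S_eq by simp
  qed
  hence "f (Tail e) = f (Head e) + 1" if "e \<in> joints" for e using that by force
  with f(1) show ?thesis by (rule that)
qed

end

section \<open>Linear relations in the Alexander matrix\<close>

text \<open>
  If no element has two predecessors, then the elements reachable from a source are closed under
  predecessors as well, so they form a whole class, which contains no second source.
\<close>
lemma generated_equiv_unique_source:
  assumes inj: "\<And>x y z. (x, z) \<in> r \<Longrightarrow> (y, z) \<in> r \<Longrightarrow> x = y"
    and a: "\<And>x. (x, a) \<notin> r" and b: "\<And>x. (x, b) \<notin> r"
    and "(a, b) \<in> generated_equiv r"
  shows "a = b"
proof -
  have "((a, a) \<in> r\<^sup>*) = ((a, b) \<in> r\<^sup>*)"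
  proof (rule generated_equiv_invariant[OF assms(4)])
    fix x y assume xy: "(x, y) \<in> r"
    show "((a, x) \<in> r\<^sup>*) = ((a, y) \<in> r\<^sup>*)"
    proof
      assume "(a, y) \<in> r\<^sup>*"
      thus "(a, x) \<in> r\<^sup>*"
      proof (cases rule: rtranclE)
        case base
        with xy a show ?thesis by blast
      next
        case (step z)
        with inj[OF xy step(2)] show ?thesis by simp
      qed
    qed (use xy in \<open>auto intro: rtrancl_into_rtrancl\<close>)
  qed
  hence "(a, b) \<in> r\<^sup>*" by simp
  thus ?thesis using b by (cases rule: rtranclE) auto
qed

context link
begin

abbreviation arc :: "'e \<Rightarrow> 'e set" where
  "arc e \<equiv> same_arc D `` {e}"

lemma sum_half_edges_at:
  fixes F :: "'e half_edge \<Rightarrow> 'b :: comm_monoid_add"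
  shows "(\<Sum>i<4. F (half_edges_at x ! i)) =
    F (Head (under_in x)) + F (Tail (under_out x)) + F (Head (over_in x)) + F (Tail (over_out x))"
  using half_edges_at_cases[of x]
proof (elim disjE conjE)
  assume "half_edges_at x = [Head (under_in x), Tail (over_out x), Tail (under_out x), Head (over_in x)]"
  thus ?thesis by (simp add: eval_nat_numeral ac_simps)
next
  assume "half_edges_at x = [Head (under_in x), Head (over_in x), Tail (under_out x), Tail (over_out x)]"
  thus ?thesis by (simp add: eval_nat_numeral ac_simps)
qed

lemma set_half_edges_at_eq:
  "set (half_edges_at x) = {Head (under_in x), Tail (under_out x), Head (over_in x), Tail (over_out x)}"
  by (auto simp: half_edges_at_def)

lemma incident_joints:
  assumes "x \<in> crossings D"
  shows "under_in x \<in> joints" "under_out x \<in> joints" "over_in x \<in> joints" "over_out x \<in> joints"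
proof -
  have h: "h \<in> half_edges D" if "h \<in> set (half_edges_at x)" for h
    using that assms by (auto simp: half_edges_def)
  show "under_in x \<in> joints" "over_in x \<in> joints"
    using h[of "Head (under_in x)"] h[of "Head (over_in x)"]
    by (simp_all add: joints_iff set_half_edges_at_eq)
  show "under_out x \<in> joints" "over_out x \<in> joints"
    using h[of "Tail (under_out x)"] h[of "Tail (over_out x)"]
    by (simp_all add: joints_iff set_half_edges_at_eq Tail_half_edge_iff)
qed

lemma joints_subset: "joints \<subseteq> edges D"
  by (auto simp: joints_def)

lemma distinct_half_edges_at:
  assumes "x \<in> crossings D"
  shows "distinct (half_edges_at x)"
  unfolding distinct_conv_nth
proof (intro allI impI)
  fix i j assume ij: "i < length (half_edges_at x)" "j < length (half_edges_at x)" "i \<noteq> j"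
  show "half_edges_at x ! i \<noteq> half_edges_at x ! j"
  proof
    assume "half_edges_at x ! i = half_edges_at x ! j"
    hence "(x, i) = (x, j)" by (intro inj_onD[OF inj_half_edges]) (use assms ij in auto)
    with ij show False by simp
  qed
qed

lemma over_out_inj:
  assumes "x \<in> crossings D" "y \<in> crossings D" "over_out x = over_out y"
  shows "x = y"
  using vertex_eq[OF assms(1), of "Tail (over_out x)"] vertex_eq[OF assms(2), of "Tail (over_out x)"]
    assms(3) by (simp add: set_half_edges_at_eq)

lemma under_out_inj:
  assumes "x \<in> crossings D" "y \<in> crossings D" "under_out x = under_out y"
  shows "x = y"
  using vertex_eq[OF assms(1), of "Tail (under_out x)"] vertex_eq[OF assms(2), of "Tail (under_out x)"]
    assms(3) by (simp add: set_half_edges_at_eq)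

lemma over_out_neq_under_out:
  assumes "x \<in> crossings D" "y \<in> crossings D"
  shows "over_out x \<noteq> under_out y"
proof
  assume eq: "over_out x = under_out y"
  hence "x = y"
    using vertex_eq[OF assms(1), of "Tail (over_out x)"] vertex_eq[OF assms(2), of "Tail (over_out x)"]
    by (simp add: set_half_edges_at_eq)
  with eq distinct_half_edges_at[OF assms(1)] show False
    by (auto simp: half_edges_at_def split: if_splits)
qed

lemma same_arc_eq: "same_arc D = generated_equiv {(over_in x, over_out x) | x. x \<in> crossings D}"
  by (simp add: same_arc_def)

lemma arc_over_out: "x \<in> crossings D \<Longrightarrow> arc (over_out x) = arc (over_in x)"
  unfolding same_arc_eq generated_equiv_class_eq
  by (rule generated_equiv_sym, rule generated_equiv_base) auto

lemma arc_in_arcs: "e \<in> edges D \<Longrightarrow> arc e \<in> arcs D"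
  by (auto simp: arcs_def quotient_def)

lemma finite_arcs: "finite (arcs D)"
  using finite_edges by (simp add: arcs_def quotient_def)

lemma arcs_nonempty: "arcs D \<noteq> {}"
  using link_diagram by (auto simp: arcs_def quotient_def link_diagram_def)

lemma crossing_arcs:
  assumes "x \<in> crossings D"
  shows "over_arc D x \<in> arcs D" "right_arc D x \<in> arcs D" "left_arc D x \<in> arcs D"
  using assms incident_joints joints_subset
  by (auto simp: over_arc_def right_arc_def left_arc_def intro!: arc_in_arcs)

text \<open>
  The arc leaving a crossing underneath starts there, and an arc has only one start.
\<close>
lemma card_crossings_le: "card (crossings D) \<le> card (arcs D)"
proof (rule card_inj_on_le)
  show "inj_on (\<lambda>x. arc (under_out x)) (crossings D)"
  proof (rule inj_onI)
    fix x y assume xy: "x \<in> crossings D" "y \<in> crossings D" "arc (under_out x) = arc (under_out y)"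
    have "under_out x = under_out y"
    proof (rule generated_equiv_unique_source)
      show "(under_out x, under_out y) \<in> generated_equiv {(over_in x, over_out x) | x. x \<in> crossings D}"
        using xy(3) unfolding same_arc_eq generated_equiv_class_eq .
    qed (use xy over_out_inj over_out_neq_under_out in \<open>auto, metis+\<close>)
    with xy show "x = y" by (auto intro: under_out_inj)
  qed
qed (use finite_arcs incident_joints joints_subset in \<open>auto intro!: arc_in_arcs\<close>)

text \<open>
  Give the edge \<open>e\<close> the weight \<open>\<phi> e = t\<^sup>-\<^sup>k\<close>, where \<open>k\<close> is the number of the region on its left. For a fixed
  arc \<open>a\<close>, sum \<open>\<phi> e\<close> at the tail minus \<open>\<phi> e\<close> at the head over the edges \<open>e\<close> of \<open>a\<close>. The sum is zero edge
  by edge; collected crossing by crossing, the contribution of \<open>x\<close> is the entry of the Alexander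
  matrix at \<open>x\<close> and \<open>a\<close> times the weight of one of the under-edges of \<open>x\<close>, up to a sign.
\<close>
theorem row_relation:
  obtains u v :: "'e crossing \<Rightarrow> laurent"
  where "\<And>x. x \<in> crossings D \<Longrightarrow> v x * u x = 1"
    and "\<And>a. (\<Sum>x\<in>crossings D. u x * alexander_entry D x a) = 0"
proof -
  obtain f :: "'e half_edge \<Rightarrow> int"
    where f: "\<And>h k. (h, k) \<in> sectors \<Longrightarrow> f h = f k"
      and f_Tail: "\<And>e. e \<in> joints \<Longrightarrow> f (Tail e) = f (Head e) + 1"
    using alexander_numbering by blast
  define \<phi> where "\<phi> e = t_power (- f (Tail e))" for e
  define u where "u x = (if positive x then - \<phi> (under_out x) else \<phi> (under_in x))" for x
  define v where "v x = (if positive x then - t_power (f (Tail (under_out x)))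
    else t_power (f (Tail (under_in x))))" for x
  have vu: "v x * u x = 1" for x
    by (simp add: u_def v_def \<phi>_def t_power_def mult_single)
  define val where "val a h = (case h of Head e \<Rightarrow> - \<phi> e * of_bool (a = arc e)
    | Tail e \<Rightarrow> \<phi> e * of_bool (a = arc e))" for a h
  have shift: "\<phi> d = t_power 1 * \<phi> e" if "f (Tail e) = f (Tail d) + 1" for d e
    using that by (simp add: \<phi>_def t_power_def mult_single)
  have same: "\<phi> d = \<phi> e" if "f (Tail e) = f (Tail d)" for d e
    using that by (simp add: \<phi>_def)
  \<comment> \<open>The numbering fixes the weights of all four edges at a crossing in terms of one of them.\<close>
  have local: "u x * alexander_entry D x a = (\<Sum>i<4. val a (half_edges_at x ! i))"
    if x: "x \<in> crossings D" for x a
  proof -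
    have s: "f (half_edges_at x ! i) = f (opposite (half_edges_at x ! (Suc i mod 4)))" if "i < 4" for i
      using f[OF sectorsI[OF x that]] .
    have mod: "Suc 0 mod 4 = 1" "Suc 1 mod 4 = 2" "Suc 2 mod 4 = 3" "Suc 3 mod 4 = 0" by simp_all
    have s0: "f (half_edges_at x ! 0) = f (opposite (half_edges_at x ! 1))"
      and s1: "f (half_edges_at x ! 1) = f (opposite (half_edges_at x ! 2))"
      and s2: "f (half_edges_at x ! 2) = f (opposite (half_edges_at x ! 3))"
      and s3: "f (half_edges_at x ! 3) = f (opposite (half_edges_at x ! 0))"
      using s[of 0] s[of 1] s[of 2] s[of 3] unfolding mod by auto
    note j = incident_joints[OF x, THEN f_Tail]
    show ?thesis
    proof (cases "positive x")
      case True
      hence h: "half_edges_at x ! 0 = Head (under_in x)" "half_edges_at x ! 1 = Tail (over_out x)"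
        "half_edges_at x ! 2 = Tail (under_out x)" "half_edges_at x ! 3 = Head (over_in x)"
        by (simp_all add: half_edges_at_def eval_nat_numeral)
      have "f (Tail (under_out x)) = f (Tail (under_in x)) + 1"
        "f (Tail (under_out x)) = f (Tail (over_out x)) + 1"
        "f (Tail (under_out x)) = f (Tail (over_in x))"
        using s0 s1 s2 s3 j unfolding h opposite.simps by linarith+
      hence \<phi>: "\<phi> (under_in x) = t_power 1 * \<phi> (under_out x)"
        "\<phi> (over_out x) = t_power 1 * \<phi> (under_out x)" "\<phi> (over_in x) = \<phi> (under_out x)"
        by (auto intro: shift same)
      show ?thesis unfolding sum_half_edges_at
        using True by (simp add: val_def u_def \<phi> alexander_entry_def over_arc_def right_arc_def
            left_arc_def arc_over_out[OF x] algebra_simps)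
    next
      case False
      hence h: "half_edges_at x ! 0 = Head (under_in x)" "half_edges_at x ! 1 = Head (over_in x)"
        "half_edges_at x ! 2 = Tail (under_out x)" "half_edges_at x ! 3 = Tail (over_out x)"
        by (simp_all add: half_edges_at_def eval_nat_numeral)
      have "f (Tail (under_in x)) = f (Tail (under_out x)) + 1"
        "f (Tail (under_in x)) = f (Tail (over_in x)) + 1"
        "f (Tail (under_in x)) = f (Tail (over_out x))"
        using s0 s1 s2 s3 j unfolding h opposite.simps by linarith+
      hence \<phi>: "\<phi> (under_out x) = t_power 1 * \<phi> (under_in x)"
        "\<phi> (over_in x) = t_power 1 * \<phi> (under_in x)" "\<phi> (over_out x) = \<phi> (under_in x)"
        by (auto intro: shift same)
      show ?thesis unfolding sum_half_edges_at
        using False by (simp add: val_def u_def \<phi> alexander_entry_def over_arc_def right_arc_def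
            left_arc_def arc_over_out[OF x] algebra_simps)
    qed
  qed
  have "(\<Sum>x\<in>crossings D. u x * alexander_entry D x a) = 0" for a
  proof -
    have "(\<Sum>x\<in>crossings D. u x * alexander_entry D x a) = (\<Sum>h\<in>half_edges D. val a h)"
      unfolding sum_half_edges by (intro sum.cong refl local)
    also have "\<dots> = 0" unfolding sum_joints by (simp add: val_def)
    finally show ?thesis .
  qed
  with vu show ?thesis by (rule that)
qed

lemma column_relation:
  assumes "x \<in> crossings D"
  shows "(\<Sum>a\<in>arcs D. alexander_entry D x a) = 0"
proof -
  have delta: "(\<Sum>a\<in>arcs D. p * of_bool (a = b)) = p" if "b \<in> arcs D" for p :: laurent and b
    using that finite_arcs by simp
  have "(\<Sum>a\<in>arcs D. alexander_entry D x a) = (1 - t_power 1) + t_power 1 - 1"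
    using delta[OF crossing_arcs(1)[OF assms], of "1 - t_power 1"]
      delta[OF crossing_arcs(2)[OF assms], of "t_power 1"] delta[OF crossing_arcs(3)[OF assms], of 1]
    unfolding alexander_entry_def by (simp add: sum.distrib sum_subtractf)
  thus ?thesis by simp
qed

end

section \<open>A minor that is a unit\<close>

text \<open>
  At most one element of \<open>X\<close> is missing from the range of \<open>r\<close>, and the relation can be solved for its
  row because its coefficient is a unit.
\<close>
lemma row_combination:
  fixes N :: "'x \<Rightarrow> 'b \<Rightarrow> 'r :: comm_ring_1"
  assumes X: "finite X" "card X \<le> Suc k" and r: "inj_on r {..<k}" "r ` {..<k} \<subseteq> X"
    and relation: "\<And>b. b \<in> B \<Longrightarrow> (\<Sum>x\<in>X. u x * N x b) = 0"
    and unit: "\<And>x. x \<in> X \<Longrightarrow> v x * u x = 1" and x: "x \<in> X"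
  shows "\<exists>p. \<forall>b\<in>B. N x b = (\<Sum>l<k. p l * N (r l) b)"
proof (cases "x \<in> r ` {..<k}")
  case True
  then obtain j where j: "j < k" "x = r j" by auto
  have "(\<Sum>l<k. of_bool (l = j) * N (r l) b) = N x b" for b
    using j by (simp add: if_distrib[of "\<lambda>z. z * _"] cong: if_cong)
  thus ?thesis by metis
next
  case False
  have "card (insert x (r ` {..<k})) = Suc k" using False r(1) by (simp add: card_image)
  hence X_eq: "X = insert x (r ` {..<k})"
    using X r(2) x by (intro card_seteq[symmetric]) auto
  have "N x b = (\<Sum>l<k. - v x * u (r l) * N (r l) b)" if "b \<in> B" for b
  proof -
    have "u x * N x b + (\<Sum>l<k. u (r l) * N (r l) b) = 0"
      using relation[OF that] False r(1) unfolding X_eq by (simp add: sum.reindex)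
    hence "v x * (u x * N x b) = v x * - (\<Sum>l<k. u (r l) * N (r l) b)"
      by (simp add: add_eq_0_iff2)
    moreover have "v x * (u x * N x b) = N x b" using unit[OF x] by (simp flip: mult.assoc)
    ultimately show ?thesis by (simp add: sum_distrib_left sum_negf mult.assoc)
  qed
  thus ?thesis by (intro exI[of _ "\<lambda>l. - v x * u (r l)"]) blast
qed

text \<open>
  Rows and columns of the second minor are combinations of those of the first, so its matrix arises
  from that of the first by multiplication with square matrices on both sides.
\<close>
lemma minor_dvd_minor:
  fixes M :: "'x \<Rightarrow> 'a \<Rightarrow> 'r :: comm_ring_1"
  assumes X: "finite X" "card X \<le> Suc k" and A: "finite A" "card A \<le> Suc k"
    and rows: "\<And>a. a \<in> A \<Longrightarrow> (\<Sum>x\<in>X. u x * M x a) = 0" "\<And>x. x \<in> X \<Longrightarrow> v x * u x = 1"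
    and columns: "\<And>x. x \<in> X \<Longrightarrow> (\<Sum>a\<in>A. M x a) = 0"
    and r: "inj_on r {..<k}" "r ` {..<k} \<subseteq> X" and a: "inj_on a {..<k}" "a ` {..<k} \<subseteq> A"
    and r': "r' ` {..<k} \<subseteq> X" and a': "a' ` {..<k} \<subseteq> A"
  shows "det (mat k k (\<lambda>(i, j). M (r i) (a j))) dvd det (mat k k (\<lambda>(i, j). M (r' i) (a' j)))"
proof -
  have "\<forall>i<k. \<exists>p. \<forall>b\<in>A. M (r' i) b = (\<Sum>l<k. p l * M (r l) b)"
  proof (intro allI impI)
    fix i assume "i < k"
    thus "\<exists>p. \<forall>b\<in>A. M (r' i) b = (\<Sum>l<k. p l * M (r l) b)"
      using r' by (intro row_combination[OF X r, of A u M v]) (auto simp: rows)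
  qed
  then obtain p where p: "\<And>i b. i < k \<Longrightarrow> b \<in> A \<Longrightarrow> M (r' i) b = (\<Sum>l<k. p i l * M (r l) b)"
    by metis
  have "\<forall>j<k. \<exists>q. \<forall>x\<in>X. M x (a' j) = (\<Sum>l<k. q l * M x (a l))"
  proof (intro allI impI)
    fix j assume "j < k"
    thus "\<exists>q. \<forall>x\<in>X. M x (a' j) = (\<Sum>l<k. q l * M x (a l))"
      using a' by (intro row_combination[OF A a, of X "\<lambda>_. 1" "\<lambda>c x. M x c" "\<lambda>_. 1"])
        (auto simp: columns)
  qed
  then obtain q where q: "\<And>j x. j < k \<Longrightarrow> x \<in> X \<Longrightarrow> M x (a' j) = (\<Sum>l<k. q j l * M x (a l))"
    by metis
  let ?M = "mat k k (\<lambda>(i, j). M (r i) (a j))"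
  let ?P = "mat k k (\<lambda>(i, l). p i l)" and ?Q = "mat k k (\<lambda>(l, j). q j l)"
  have "mat k k (\<lambda>(i, j). M (r' i) (a' j)) = ?P * (?M * ?Q)"
  proof (rule eq_matI)
    fix i j assume "i < dim_row (?P * (?M * ?Q))" "j < dim_col (?P * (?M * ?Q))"
    hence ij: "i < k" "j < k" by auto
    have "(?P * (?M * ?Q)) $$ (i, j) = (\<Sum>l<k. p i l * (\<Sum>m<k. M (r l) (a m) * q j m))"
      using ij by (simp add: scalar_prod_def lessThan_atLeast0)
    also have "\<dots> = (\<Sum>l<k. p i l * M (r l) (a' j))"
      using ij r(2) by (intro sum.cong refl arg_cong[where f = "(*) _"], subst q) (auto simp: mult.commute)
    also have "\<dots> = M (r' i) (a' j)" using ij a' p[of i "a' j"] by auto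
    finally show "mat k k (\<lambda>(i, j). M (r' i) (a' j)) $$ (i, j) = (?P * (?M * ?Q)) $$ (i, j)"
      using ij by simp
  qed auto
  moreover have "det (?P * (?M * ?Q)) = det ?P * det (?M * ?Q)"
    by (rule det_mult[where n = k]) auto
  moreover have "det (?M * ?Q) = det ?M * det ?Q"
    by (rule det_mult[where n = k]) auto
  ultimately show ?thesis by simp
qed

context link
begin

text \<open>
  Some minor exists, since otherwise 0 would be a greatest common divisor. It divides all minors,
  hence the Alexander polynomial.
\<close>
lemma unit_minor:
  assumes "is_alexander_polynomial D \<Delta>" and "eq_up_to_unit \<Delta> 1"
    and k: "k = card (arcs D) - 1"
  obtains r a s where "inj_on r {..<k}" "r ` {..<k} \<subseteq> crossings D"
    "inj_on a {..<k}" "a ` {..<k} \<subseteq> arcs D"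
    "s * det (mat k k (\<lambda>(i, j). alexander_entry D (r i) (a j))) = 1"
proof -
  have arcs_pos: "card (arcs D) > 0" using finite_arcs arcs_nonempty by (simp add: card_gt_0_iff)
  have \<Delta>: "d dvd \<Delta>" if "\<forall>m\<in>alexander_minors D k. d dvd m" for d
    using assms(1) that unfolding is_alexander_polynomial_def k by blast
  have \<Delta>_unit: "\<Delta> dvd 1"
  proof -
    obtain j where "\<Delta> = t_power j \<or> \<Delta> = - t_power j" using assms(2) by (auto simp: eq_up_to_unit_def)
    hence "1 = \<Delta> * t_power (- j) \<or> 1 = \<Delta> * - t_power (- j)"
      by (auto simp: t_power_def mult_single)
    thus ?thesis by (metis dvdI)
  qed
  have "alexander_minors D k \<noteq> {}"
  proof
    assume "alexander_minors D k = {}"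
    hence "0 dvd \<Delta>" using \<Delta>[of 0] by simp
    with \<Delta>_unit show False by (metis dvd_trans dvd_0_left_iff zero_neq_one)
  qed
  then obtain r a where ra: "inj_on r {..<k}" "r ` {..<k} \<subseteq> crossings D"
    "inj_on a {..<k}" "a ` {..<k} \<subseteq> arcs D"
    unfolding alexander_minors_def by blast
  let ?m = "det (mat k k (\<lambda>(i, j). alexander_entry D (r i) (a j)))"
  obtain u v where rows: "\<And>x. x \<in> crossings D \<Longrightarrow> v x * u x = 1"
    "\<And>a. (\<Sum>x\<in>crossings D. u x * alexander_entry D x a) = 0"
    by (rule row_relation) (rule that)
  have "?m dvd m" if "m \<in> alexander_minors D k" for m
  proof -
    from that obtain r' a' where
      "m = det (mat k k (\<lambda>(i, j). alexander_entry D (r' i) (a' j)))"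
      "r' ` {..<k} \<subseteq> crossings D" "a' ` {..<k} \<subseteq> arcs D"
      unfolding alexander_minors_def by blast
    moreover have "card (crossings D) \<le> Suc k" "card (arcs D) \<le> Suc k"
      using card_crossings_le arcs_pos k by auto
    ultimately show ?thesis
      using minor_dvd_minor[OF finite_crossings _ finite_arcs, of k u "alexander_entry D" v r a r' a']
        rows column_relation ra by simp
  qed
  hence "?m dvd \<Delta>" by (intro \<Delta> ballI)
  from dvd_trans[OF this \<Delta>_unit] obtain s where "1 = ?m * s" by (elim dvdE)
  hence "s * ?m = 1" by (simp add: mult.commute)
  with ra show ?thesis by (rule that)
qed

text \<open>
  Multiplying the chosen rows by the adjugate of a unit minor and by the inverse of the minor turns
  the chosen columns into the identity matrix. The entries in the remaining column are then -1, as
  the entries of each row add up to zero.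
\<close>
theorem arc_difference_in_row_span:
  assumes "is_alexander_polynomial D \<Delta>" and "eq_up_to_unit \<Delta> 1"
    and "b \<in> arcs D" "b' \<in> arcs D"
  shows "\<exists>q. \<forall>c\<in>arcs D. of_bool (c = b) - of_bool (c = b') = (\<Sum>x\<in>crossings D. q x * alexander_entry D x c)"
proof -
  define k where "k = card (arcs D) - 1"
  obtain r a s where r: "inj_on r {..<k}" "r ` {..<k} \<subseteq> crossings D"
    and a: "inj_on a {..<k}" "a ` {..<k} \<subseteq> arcs D"
    and s: "s * det (mat k k (\<lambda>(i, j). alexander_entry D (r i) (a j))) = 1"
    using unit_minor[OF assms(1,2) k_def] .
  let ?M = "mat k k (\<lambda>(i, j). alexander_entry D (r i) (a j))"
  have arcs_pos: "card (arcs D) > 0" using finite_arcs arcs_nonempty by (simp add: card_gt_0_iff)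
  have "card (arcs D - a ` {..<k}) = 1"
    using a arcs_pos by (simp add: card_Diff_subset card_image k_def)
  \<comment> \<open>\<open>z\<close> is the only arc whose column is not in the minor; it serves as the base point.\<close>
  then obtain z where "arcs D - a ` {..<k} = {z}" by (auto simp: card_1_singleton_iff)
  hence arcs_eq: "arcs D = insert z (a ` {..<k})" and z: "z \<notin> a ` {..<k}" using a by auto
  have M: "?M \<in> carrier_mat k k" by simp
  have spanned: "\<exists>q. \<forall>c\<in>arcs D. of_bool (c = b) - of_bool (c = z) = (\<Sum>x\<in>crossings D. q x * alexander_entry D x c)"
    if "b \<in> arcs D" for b
  proof (cases "b = z")
    case True
    thus ?thesis by (intro exI[of _ "\<lambda>_. 0"]) simp
  next
    case False
    with that arcs_eq obtain j where j: "j < k" "b = a j" by auto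
    define q where "q x = (\<Sum>i<k. of_bool (x = r i) * (s * adj_mat ?M $$ (j, i)))" for x
    have q: "(\<Sum>x\<in>crossings D. q x * alexander_entry D x c)
        = (\<Sum>i<k. s * adj_mat ?M $$ (j, i) * alexander_entry D (r i) c)" for c
    proof -
      have "(\<Sum>x\<in>crossings D. q x * alexander_entry D x c) =
        (\<Sum>i<k. \<Sum>x\<in>crossings D. if x = r i then s * adj_mat ?M $$ (j, i) * alexander_entry D x c else 0)"
        unfolding q_def sum_distrib_right by (subst sum.swap) (auto intro!: sum.cong)
      also have "\<dots> = (\<Sum>i<k. s * adj_mat ?M $$ (j, i) * alexander_entry D (r i) c)"
        using r(2) finite_crossings by (intro sum.cong refl) auto
      finally show ?thesis .
    qed
    have at_a: "(\<Sum>i<k. s * adj_mat ?M $$ (j, i) * alexander_entry D (r i) (a l)) = of_bool (l = j)"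
      if l: "l < k" for l
    proof -
      have "(adj_mat ?M * ?M) $$ (j, l) = det ?M * of_bool (l = j)"
        using j l by (subst adj_mat(3)[OF M]) auto
      moreover have "(adj_mat ?M * ?M) $$ (j, l) = (\<Sum>i<k. adj_mat ?M $$ (j, i) * alexander_entry D (r i) (a l))"
        using j l adj_mat(1)[OF M] by (simp add: scalar_prod_def lessThan_atLeast0)
      ultimately have "s * (\<Sum>i<k. adj_mat ?M $$ (j, i) * alexander_entry D (r i) (a l)) = (s * det ?M) * of_bool (l = j)"
        by (simp only: mult.assoc)
      thus ?thesis using s by (simp add: sum_distrib_left mult.assoc)
    qed
    have at_o: "(\<Sum>i<k. s * adj_mat ?M $$ (j, i) * alexander_entry D (r i) z) = - 1"
    proof -
      have "alexander_entry D (r i) z = - (\<Sum>l<k. alexander_entry D (r i) (a l))" if "i < k" for i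
      proof -
        have "r i \<in> crossings D" using r(2) that by auto
        from column_relation[OF this] show ?thesis
          using z a(1) unfolding arcs_eq by (simp add: sum.reindex add_eq_0_iff2)
      qed
      hence "(\<Sum>i<k. s * adj_mat ?M $$ (j, i) * alexander_entry D (r i) z)
        = - (\<Sum>l<k. \<Sum>i<k. s * adj_mat ?M $$ (j, i) * alexander_entry D (r i) (a l))"
        by (subst sum.swap) (simp add: sum_distrib_left sum_negf)
      also have "\<dots> = - 1" using j(1) by (simp add: at_a)
      finally show ?thesis .
    qed
    show ?thesis
    proof (intro exI[of _ q] ballI)
      fix c assume "c \<in> arcs D"
      then consider "c = z" | l where "l < k" "c = a l" using arcs_eq by auto
      thus "of_bool (c = b) - of_bool (c = z) = (\<Sum>x\<in>crossings D. q x * alexander_entry D x c)"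
      proof cases
        case 1
        with False show ?thesis unfolding q by (simp add: at_o)
      next
        case 2
        have "c \<noteq> z" using 2 z by auto
        moreover have "c = b \<longleftrightarrow> l = j" using 2 j a(1) by (auto dest: inj_onD)
        ultimately show ?thesis unfolding q 2(2) at_a[OF 2(1)] by (simp add: 2(2))
      qed
    qed
  qed
  from spanned[OF assms(3)] spanned[OF assms(4)] obtain q q'
    where q: "\<And>c. c \<in> arcs D \<Longrightarrow> of_bool (c = b) - of_bool (c = z) = (\<Sum>x\<in>crossings D. q x * alexander_entry D x c)"
      and q': "\<And>c. c \<in> arcs D \<Longrightarrow> of_bool (c = b') - of_bool (c = z) = (\<Sum>x\<in>crossings D. q' x * alexander_entry D x c)"
    by blast
  have "of_bool (c = b) - of_bool (c = b') = (\<Sum>x\<in>crossings D. (q x - q' x) * alexander_entry D x c)"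
    if "c \<in> arcs D" for c
    using q[OF that] q'[OF that] by (simp add: left_diff_distrib sum_subtractf algebra_simps)
  thus ?thesis by (intro exI[of _ "\<lambda>x. q x - q' x"] ballI)
qed

end

section \<open>Linear colorings\<close>

text \<open>
  The additive group of Laurent polynomials is free abelian on the powers of \<open>t\<close>.
\<close>
lemma frag_hom_eq:
  fixes f g :: "laurent \<Rightarrow> 'g" and G (structure)
  assumes G: "group G" and f: "f \<in> hom (free_Abelian_group (UNIV :: int set)) G"
    and g: "g \<in> hom (free_Abelian_group (UNIV :: int set)) G"
    and eq: "\<And>k. f (frag_of k) = g (frag_of k)"
  shows "f p = g p"
proof -
  interpret f: group_hom "free_Abelian_group (UNIV :: int set)" G f
    using G f by (simp add: group_hom_def group_hom_axioms_def)
  interpret g: group_hom "free_Abelian_group (UNIV :: int set)" G g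
    using G g by (simp add: group_hom_def group_hom_axioms_def)
  have hom_diff: "h (a - b) = h a \<otimes> inv (h b)" if "group_hom (free_Abelian_group (UNIV :: int set)) G h"
    for h :: "laurent \<Rightarrow> 'g" and a b
  proof -
    interpret h: group_hom "free_Abelian_group (UNIV :: int set)" G h by fact
    have "h ((a - b) + b) = h (a - b) \<otimes> h b" using h.hom_mult[of "a - b" b] by simp
    moreover have "h x \<in> carrier G" for x using h.hom_closed[of x] by simp
    ultimately show ?thesis using f.inv_solve_right by simp
  qed
  have "Poly_Mapping.keys p \<subseteq> UNIV" by simp
  thus ?thesis
  proof (induction rule: frag_induction)
    case zero
    show ?case using f.hom_one g.hom_one by simp
  next
    case (one x)
    show ?case by (rule eq)
  next
    case (diff a b)
    thus ?case using hom_diff[OF f.group_hom_axioms] hom_diff[OF g.group_hom_axioms] by simp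
  qed
qed

text \<open>
  An automorphism of an abelian group makes the group a module over \<open>\<int>[t, t\<^sup>-\<^sup>1]\<close>: for fixed \<open>d\<close>, the map
  \<open>p \<mapsto> act p d\<close> is the additive extension of \<open>t\<^sup>k \<mapsto> \<tau>\<^sup>k d\<close>, and the module laws need only be checked on
  powers of \<open>t\<close>.
\<close>
lemma laurent_action:
  fixes G :: "('g, 'm) monoid_scheme" (structure)
  assumes "comm_group G" and \<tau>: "\<tau> \<in> auto G"
  obtains act :: "laurent \<Rightarrow> 'g \<Rightarrow> 'g" where
    "\<And>p d. d \<in> carrier G \<Longrightarrow> act p d \<in> carrier G"
    "\<And>p q d. d \<in> carrier G \<Longrightarrow> act (p + q) d = act p d \<otimes> act q d"
    "\<And>p q d. d \<in> carrier G \<Longrightarrow> act (p * q) d = act p (act q d)"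
    "\<And>p d e. d \<in> carrier G \<Longrightarrow> e \<in> carrier G \<Longrightarrow> act p (d \<otimes> e) = act p d \<otimes> act p e"
    "\<And>d. d \<in> carrier G \<Longrightarrow> act 1 d = d"
    "\<And>d. d \<in> carrier G \<Longrightarrow> act (t_power 1) d = \<tau> d"
proof -
  interpret comm_group G by fact
  interpret Aut: group "AutoGroup G" by (rule AutoGroup)
  define T where "T k = \<tau> [^]\<^bsub>AutoGroup G\<^esub> (k :: int)" for k
  have \<tau>': "\<tau> \<in> carrier (AutoGroup G)" using \<tau> by (simp add: AutoGroup_def)
  have T_auto: "T k \<in> auto G" for k
    using Aut.int_pow_closed[OF \<tau>', of k] by (simp add: T_def AutoGroup_def)
  have T_closed: "T k d \<in> carrier G" if "d \<in> carrier G" for k d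
    using T_auto[of k] that by (auto simp: auto_def hom_def)
  have T_mult: "T k (d \<otimes> e) = T k d \<otimes> T k e" if "d \<in> carrier G" "e \<in> carrier G" for k d e
    using T_auto[of k] that by (auto simp: auto_def hom_def)
  have T_add: "T (j + k) d = T j (T k d)" if "d \<in> carrier G" for j k d
  proof -
    have "T (j + k) = T j \<otimes>\<^bsub>AutoGroup G\<^esub> T k"
      unfolding T_def by (rule Aut.int_pow_mult[OF \<tau>', symmetric, THEN sym])
    also have "\<dots> = compose (carrier G) (T j) (T k)"
      using T_auto[of j] T_auto[of k] by (auto simp: AutoGroup_def BijGroup_def auto_def)
    finally show ?thesis using that by (simp add: compose_def)
  qed
  have T_0: "T 0 d = d" if "d \<in> carrier G" for d
    using that by (simp add: T_def AutoGroup_def BijGroup_def)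
  have T_1: "T 1 d = \<tau> d" for d
    using Aut.int_pow_1[OF \<tau>'] by (simp add: T_def)
  let ?F = "free_Abelian_group (UNIV :: int set)"
  have "\<forall>d\<in>carrier G. \<exists>h. h \<in> hom ?F G \<and> (\<forall>k. h (frag_of k) = T k d)"
  proof
    fix d assume d: "d \<in> carrier G"
    have "(\<lambda>k. T k d) ` UNIV \<subseteq> carrier G" using d T_closed by auto
    then obtain h where "h \<in> hom ?F G" "\<And>k. k \<in> UNIV \<Longrightarrow> h (frag_of k) = T k d"
      using free_Abelian_group_universal by blast
    thus "\<exists>h. h \<in> hom ?F G \<and> (\<forall>k. h (frag_of k) = T k d)" by auto
  qed
  then obtain \<phi> where \<phi>: "\<And>d. d \<in> carrier G \<Longrightarrow> \<phi> d \<in> hom ?F G"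
    and \<phi>_frag: "\<And>d k. d \<in> carrier G \<Longrightarrow> \<phi> d (frag_of k) = T k d"
    by metis
  have closed: "\<phi> d p \<in> carrier G" if "d \<in> carrier G" for d p
    using \<phi>[OF that] by (auto simp: hom_def)
  have add: "\<phi> d (p + q) = \<phi> d p \<otimes> \<phi> d q" if "d \<in> carrier G" for d p q
    using \<phi>[OF that] by (auto simp: hom_def)
  have mult_d: "\<phi> (d \<otimes> e) p = \<phi> d p \<otimes> \<phi> e p" if d: "d \<in> carrier G" and e: "e \<in> carrier G" for d e p
  proof (rule frag_hom_eq[OF is_group \<phi>])
    show "(\<lambda>p. \<phi> d p \<otimes> \<phi> e p) \<in> hom ?F G"
      using d e by (intro homI) (auto simp: closed add m_ac)
  qed (use d e in \<open>auto simp: \<phi>_frag T_mult\<close>)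
  have shift: "\<phi> d (frag_of k * q) = T k (\<phi> d q)" if d: "d \<in> carrier G" for d k q
  proof (rule frag_hom_eq[OF is_group])
    show "(\<lambda>q. \<phi> d (frag_of k * q)) \<in> hom ?F G"
      using d by (intro homI) (auto simp: closed add distrib_left)
    show "(\<lambda>q. T k (\<phi> d q)) \<in> hom ?F G"
      using d by (intro homI) (auto simp: closed add T_closed T_mult)
  qed (use d in \<open>auto simp: mult_single \<phi>_frag T_add\<close>)
  have mult: "\<phi> d (p * q) = \<phi> (\<phi> d q) p" if d: "d \<in> carrier G" for d p q
  proof (rule frag_hom_eq[OF is_group])
    show "(\<lambda>p. \<phi> d (p * q)) \<in> hom ?F G"
      using d by (intro homI) (auto simp: closed add distrib_right)
  qed (use d in \<open>auto simp: closed \<phi> shift \<phi>_frag\<close>)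
  show ?thesis
  proof (rule that[of "\<lambda>p d. \<phi> d p"])
    show "\<phi> d 1 = d" if "d \<in> carrier G" for d
      using \<phi>_frag[OF that, of 0] T_0[OF that] by (simp flip: single_one)
  qed (simp_all add: closed add mult mult_d \<phi>_frag T_1 t_power_def)
qed

context link
begin

text \<open>
  Evaluating formal combinations of arcs at \<open>v\<close> is a module homomorphism \<open>\<Phi>\<close> that kills the rows of the
  Alexander matrix, because in additive notation the crossing relation reads
  \<open>v_left = (1 - t) v_over + t v_right\<close>. Hence it kills the differences of arcs.
\<close>
theorem module_coloring_constant:
  fixes G :: "('g, 'm) monoid_scheme" (structure) and v :: "'e set \<Rightarrow> 'g"
  assumes \<Delta>: "is_alexander_polynomial D \<Delta>" "eq_up_to_unit \<Delta> 1"
    and G: "comm_group G" and \<tau>: "\<tau> \<in> auto G"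
    and v: "\<And>a. a \<in> arcs D \<Longrightarrow> v a \<in> carrier G"
    and relation: "\<And>x. x \<in> crossings D \<Longrightarrow>
      v (left_arc D x) = v (over_arc D x) \<otimes> \<tau> (inv v (over_arc D x) \<otimes> v (right_arc D x))"
    and arcs: "a \<in> arcs D" "b \<in> arcs D"
  shows "v a = v b"
proof -
  interpret comm_group G by fact
  obtain act :: "laurent \<Rightarrow> 'g \<Rightarrow> 'g" where
    closed: "\<And>p d. d \<in> carrier G \<Longrightarrow> act p d \<in> carrier G" and
    add: "\<And>p q d. d \<in> carrier G \<Longrightarrow> act (p + q) d = act p d \<otimes> act q d" and
    mult: "\<And>p q d. d \<in> carrier G \<Longrightarrow> act (p * q) d = act p (act q d)" and
    act_mult: "\<And>p d e. d \<in> carrier G \<Longrightarrow> e \<in> carrier G \<Longrightarrow> act p (d \<otimes> e) = act p d \<otimes> act p e" and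
    one: "\<And>d. d \<in> carrier G \<Longrightarrow> act 1 d = d" and
    t: "\<And>d. d \<in> carrier G \<Longrightarrow> act (t_power 1) d = \<tau> d"
    by (rule laurent_action[OF G \<tau>]) (rule that)
  have zero: "act 0 d = \<one>" if "d \<in> carrier G" for d
    using add[OF that, of 0 0] closed[OF that, of 0] by (metis add_0 r_cancel_one')
  have minus: "act (- p) d = inv (act p d)" if "d \<in> carrier G" for p d
    using add[OF that, of "- p" p] zero[OF that] closed[OF that] by (intro inv_equality[symmetric]) auto
  have act_one: "act p \<one> = \<one>" for p
    using act_mult[of \<one> \<one> p] closed[of \<one> p] by (metis one_closed r_cancel_one' r_one)
  define \<Phi> where "\<Phi> p = (\<Otimes>c\<in>arcs D. act (p c) (v c))" for p :: "'e set \<Rightarrow> laurent"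
  have v_act: "(\<lambda>c. act (p c) (v c)) \<in> arcs D \<rightarrow> carrier G" for p
    using v closed by auto
  have \<Phi>_closed: "\<Phi> p \<in> carrier G" for p
    unfolding \<Phi>_def by (rule finprod_closed[OF v_act])
  have \<Phi>_cong: "\<Phi> p = \<Phi> q" if "\<And>c. c \<in> arcs D \<Longrightarrow> p c = q c" for p q
    unfolding \<Phi>_def by (rule finprod_cong') (use that v_act in auto)
  have \<Phi>_add: "\<Phi> (\<lambda>c. p c + q c) = \<Phi> p \<otimes> \<Phi> q" for p q
  proof -
    have "\<Phi> (\<lambda>c. p c + q c) = (\<Otimes>c\<in>arcs D. act (p c) (v c) \<otimes> act (q c) (v c))"
      unfolding \<Phi>_def by (rule finprod_cong') (use v closed add in auto)
    also have "\<dots> = \<Phi> p \<otimes> \<Phi> q" unfolding \<Phi>_def by (rule finprod_multf[OF v_act v_act])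
    finally show ?thesis .
  qed
  have \<Phi>_single: "\<Phi> (\<lambda>c. p * of_bool (c = d)) = act p (v d)" if d: "d \<in> arcs D" for p d
  proof -
    have "\<Phi> (\<lambda>c. p * of_bool (c = d)) = (\<Otimes>c\<in>arcs D. if c = d then act p (v c) else \<one>)"
      unfolding \<Phi>_def by (rule finprod_cong') (use v closed zero in auto)
    also have "\<dots> = act p (v d)"
      using d finite_arcs v closed by (intro finprod_singleton_swap) auto
    finally show ?thesis .
  qed
  have \<Phi>_zero: "\<Phi> (\<lambda>c. 0) = \<one>"
    unfolding \<Phi>_def by (rule finprod_one_eqI) (use v zero in auto)
  have \<Phi>_scale: "\<Phi> (\<lambda>c. p * q c) = act p (\<Phi> q)" for p q
  proof -
    have "(\<Otimes>c\<in>A. act (p * q c) (v c)) = act p (\<Otimes>c\<in>A. act (q c) (v c))"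
      if "finite A" "A \<subseteq> arcs D" for A
      using that
    proof induction
      case (insert c A)
      thus ?case using v closed by (auto simp: Pi_def subset_iff mult act_mult)
    qed (simp add: act_one)
    thus ?thesis unfolding \<Phi>_def using finite_arcs by blast
  qed
  have \<Phi>_row: "\<Phi> (alexander_entry D x) = \<one>" if x: "x \<in> crossings D" for x
  proof -
    note arcs = crossing_arcs[OF x]
    let ?o = "v (over_arc D x)" and ?r = "v (right_arc D x)" and ?l = "v (left_arc D x)"
    have vc: "?o \<in> carrier G" "?r \<in> carrier G" "?l \<in> carrier G" using arcs v by auto
    have "\<Phi> (alexander_entry D x) = \<Phi> (\<lambda>c. ((1 - t_power 1) * of_bool (c = over_arc D x)
        + t_power 1 * of_bool (c = right_arc D x)) + (- 1) * of_bool (c = left_arc D x))"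
      by (rule \<Phi>_cong) (simp add: alexander_entry_def)
    also have "\<dots> = act (1 - t_power 1) ?o \<otimes> act (t_power 1) ?r \<otimes> act (- 1) ?l"
      by (simp only: \<Phi>_add \<Phi>_single arcs)
    also have "act (1 - t_power 1) ?o = ?o \<otimes> inv (\<tau> ?o)"
      using add[OF vc(1), of 1 "- t_power 1"] vc by (simp add: one minus t)
    also have "act (t_power 1) ?r = \<tau> ?r" by (rule t[OF vc(2)])
    also have "act (- 1) ?l = inv ?l" using vc by (simp add: minus one)
    also have "?l = ?o \<otimes> \<tau> (inv ?o \<otimes> ?r)" by (rule relation[OF x])
    also have "\<tau> (inv ?o \<otimes> ?r) = inv (\<tau> ?o) \<otimes> \<tau> ?r"
    proof -
      have hom: "group_hom G G \<tau>" using \<tau> by (simp add: group_hom_def group_hom_axioms_def auto_def is_group)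
      show ?thesis using vc group_hom.hom_mult[OF hom] group_hom.hom_inv[OF hom] by simp
    qed
    also have "?o \<otimes> inv (\<tau> ?o) \<otimes> \<tau> ?r \<otimes> inv (?o \<otimes> (inv (\<tau> ?o) \<otimes> \<tau> ?r)) = \<one>"
      using vc t closed by (metis inv_closed m_assoc m_closed r_inv)
    finally show ?thesis .
  qed
  obtain q where q: "\<And>c. c \<in> arcs D \<Longrightarrow>
      of_bool (c = a) - of_bool (c = b) = (\<Sum>x\<in>crossings D. q x * alexander_entry D x c)"
    using arc_difference_in_row_span[OF \<Delta> arcs] by blast
  have "\<Phi> (\<lambda>c. \<Sum>x\<in>X. q x * alexander_entry D x c) = \<one>" if "finite X" "X \<subseteq> crossings D" for X
    using that
  proof induction
    case (insert x X)
    thus ?case by (simp add: \<Phi>_add \<Phi>_scale \<Phi>_row act_one)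
  qed (simp add: \<Phi>_zero)
  hence "\<one> = \<Phi> (\<lambda>c. \<Sum>x\<in>crossings D. q x * alexander_entry D x c)"
    using finite_crossings by simp
  also have "\<dots> = \<Phi> (\<lambda>c. 1 * of_bool (c = a) + (- 1) * of_bool (c = b))"
    by (rule \<Phi>_cong) (simp flip: q)
  also have "\<dots> = act 1 (v a) \<otimes> act (- 1) (v b)"
    by (simp only: \<Phi>_add \<Phi>_single arcs)
  also have "\<dots> = v a \<otimes> inv (v b)" using v arcs by (simp add: one minus)
  finally show ?thesis using v arcs by (metis inv_closed inv_equality inv_inv)
qed

end

section \<open>Quandles with commuting displacements\<close>

text \<open>
  A subset of \<open>Q\<close> that is a quandle under the operations of \<open>Q\<close> and whose displacements
  \<open>L_x L_y\<^sup>-\<^sup>1\<close> commute. Medial quandles are those with an abelian displacement group.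
\<close>
locale medial_quandle =
  fixes Q :: "'q left_quasigroup" and B :: "'q set"
  assumes closed: "x \<in> B \<Longrightarrow> y \<in> B \<Longrightarrow> lmult Q x y \<in> B" "x \<in> B \<Longrightarrow> y \<in> B \<Longrightarrow> ldiv Q x y \<in> B"
    and cancel: "x \<in> B \<Longrightarrow> y \<in> B \<Longrightarrow> ldiv Q x (lmult Q x y) = y"
      "x \<in> B \<Longrightarrow> y \<in> B \<Longrightarrow> lmult Q x (ldiv Q x y) = y"
    and distrib: "x \<in> B \<Longrightarrow> y \<in> B \<Longrightarrow> z \<in> B \<Longrightarrow>
      lmult Q x (lmult Q y z) = lmult Q (lmult Q x y) (lmult Q x z)"
    and idem: "x \<in> B \<Longrightarrow> lmult Q x x = x"
    and displacements_commute: "x \<in> B \<Longrightarrow> y \<in> B \<Longrightarrow> u \<in> B \<Longrightarrow> v \<in> B \<Longrightarrow> w \<in> B \<Longrightarrow>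
      lmult Q x (ldiv Q y (lmult Q u (ldiv Q v w))) = lmult Q u (ldiv Q v (lmult Q x (ldiv Q y w)))"
begin

abbreviation mult (infixl "\<cdot>" 70) where "x \<cdot> y \<equiv> lmult Q x y"
abbreviation div (infixl "\<setminus>\<setminus>" 70) where "x \<setminus>\<setminus> y \<equiv> ldiv Q x y"

lemma div_distrib:
  assumes "x \<in> B" "y \<in> B" "z \<in> B"
  shows "x \<setminus>\<setminus> (y \<cdot> z) = (x \<setminus>\<setminus> y) \<cdot> (x \<setminus>\<setminus> z)"
proof -
  have "x \<cdot> ((x \<setminus>\<setminus> y) \<cdot> (x \<setminus>\<setminus> z)) = y \<cdot> z"
    using assms distrib[of x "x \<setminus>\<setminus> y" "x \<setminus>\<setminus> z"] by (simp add: closed cancel)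
  thus ?thesis using assms by (metis cancel(1) closed)
qed

lemma mult_div_distrib:
  assumes "x \<in> B" "y \<in> B" "z \<in> B"
  shows "x \<cdot> (y \<setminus>\<setminus> z) = (x \<cdot> y) \<setminus>\<setminus> (x \<cdot> z)"
proof -
  have "(x \<cdot> y) \<cdot> (x \<cdot> (y \<setminus>\<setminus> z)) = x \<cdot> z" using assms distrib[of x y "y \<setminus>\<setminus> z"] by (simp add: closed cancel)
  thus ?thesis using assms by (metis cancel(1) closed)
qed

lemma div_div_distrib:
  assumes "x \<in> B" "y \<in> B" "z \<in> B"
  shows "x \<setminus>\<setminus> (y \<setminus>\<setminus> z) = (x \<setminus>\<setminus> y) \<setminus>\<setminus> (x \<setminus>\<setminus> z)"
proof -
  have "(x \<setminus>\<setminus> y) \<cdot> (x \<setminus>\<setminus> (y \<setminus>\<setminus> z)) = x \<setminus>\<setminus> z" using assms div_distrib[of x y "y \<setminus>\<setminus> z"] by (simp add: closed cancel)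
  thus ?thesis using assms by (metis cancel(1) closed)
qed

text \<open>
  The displacement group. The inverse of \<open>L_x L_y\<^sup>-\<^sup>1\<close> is \<open>L_y L_x\<^sup>-\<^sup>1\<close>, so products of displacements suffice.
  Its elements are functions on the whole type of which only the values on \<open>B\<close> matter.
\<close>
inductive_set Dis :: "('q \<Rightarrow> 'q) set" where
  id: "(\<lambda>z. z) \<in> Dis"
| step: "g \<in> Dis \<Longrightarrow> x \<in> B \<Longrightarrow> y \<in> B \<Longrightarrow> (\<lambda>z. x \<cdot> (y \<setminus>\<setminus> g z)) \<in> Dis"

lemma Dis_closed: "g \<in> Dis \<Longrightarrow> z \<in> B \<Longrightarrow> g z \<in> B"
  by (induction rule: Dis.induct) (auto simp: closed)

lemma Dis_comp: "g \<in> Dis \<Longrightarrow> h \<in> Dis \<Longrightarrow> (\<lambda>z. g (h z)) \<in> Dis"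
  by (induction rule: Dis.induct) (auto intro: Dis.intros)

lemma Dis_commute_step:
  "g \<in> Dis \<Longrightarrow> x \<in> B \<Longrightarrow> y \<in> B \<Longrightarrow> z \<in> B \<Longrightarrow> x \<cdot> (y \<setminus>\<setminus> g z) = g (x \<cdot> (y \<setminus>\<setminus> z))"
proof (induction rule: Dis.induct)
  case (step g u v)
  have "x \<cdot> (y \<setminus>\<setminus> (u \<cdot> (v \<setminus>\<setminus> g z))) = u \<cdot> (v \<setminus>\<setminus> (x \<cdot> (y \<setminus>\<setminus> g z)))"
    using step by (intro displacements_commute) (auto simp: Dis_closed)
  with step show ?case by simp
qed simp

lemma Dis_commute: "g \<in> Dis \<Longrightarrow> h \<in> Dis \<Longrightarrow> z \<in> B \<Longrightarrow> g (h z) = h (g z)"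
proof (induction rule: Dis.induct)
  case (step g x y)
  thus ?case using Dis_commute_step[of h x y "g z"] Dis_closed by simp
qed simp

lemma Dis_inverse: "g \<in> Dis \<Longrightarrow> \<exists>h\<in>Dis. \<forall>z\<in>B. h (g z) = z \<and> g (h z) = z"
proof (induction rule: Dis.induct)
  case (step g x y)
  then obtain h where h: "h \<in> Dis" "\<And>z. z \<in> B \<Longrightarrow> h (g z) = z" "\<And>z. z \<in> B \<Longrightarrow> g (h z) = z"
    by blast
  have "(\<lambda>z. y \<cdot> (x \<setminus>\<setminus> z)) \<in> Dis" using Dis.step[OF Dis.id] step by simp
  hence "(\<lambda>z. h (y \<cdot> (x \<setminus>\<setminus> z))) \<in> Dis" using Dis_comp h(1) by blast
  moreover have "\<forall>z\<in>B. h (y \<cdot> (x \<setminus>\<setminus> (x \<cdot> (y \<setminus>\<setminus> g z)))) = z \<and> x \<cdot> (y \<setminus>\<setminus> g (h (y \<cdot> (x \<setminus>\<setminus> z)))) = z"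
    using h step by (auto simp: cancel closed Dis_closed)
  ultimately show ?case by - (rule bexI[rotated], assumption+)
qed (auto intro: Dis.id)

lemma Dis_hom: "g \<in> Dis \<Longrightarrow> z \<in> B \<Longrightarrow> w \<in> B \<Longrightarrow> g (z \<cdot> w) = g z \<cdot> g w"
proof (induction rule: Dis.induct)
  case (step g x y)
  have gz: "g z \<in> B" and gw: "g w \<in> B" using step Dis_closed by auto
  have "x \<cdot> (y \<setminus>\<setminus> (g z \<cdot> g w)) = x \<cdot> ((y \<setminus>\<setminus> g z) \<cdot> (y \<setminus>\<setminus> g w))"
    using step gz gw by (subst div_distrib) auto
  also have "\<dots> = (x \<cdot> (y \<setminus>\<setminus> g z)) \<cdot> (x \<cdot> (y \<setminus>\<setminus> g w))"
    using step gz gw by (intro distrib closed)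
  finally show ?case using step by simp
qed simp

text \<open>
  The displacement group is normalized by the left translations, which are automorphisms and hence
  conjugate \<open>L_x L_y\<^sup>-\<^sup>1\<close> to a map of the same form.
\<close>
lemma Dis_conjugate:
  assumes "e \<in> B"
  shows "g \<in> Dis \<Longrightarrow> \<exists>h\<in>Dis. \<forall>z\<in>B. e \<cdot> g z = h (e \<cdot> z)"
proof (induction rule: Dis.induct)
  case (step g x y)
  then obtain h where h: "h \<in> Dis" "\<And>z. z \<in> B \<Longrightarrow> e \<cdot> g z = h (e \<cdot> z)" by blast
  have "(\<lambda>z. (e \<cdot> x) \<cdot> ((e \<cdot> y) \<setminus>\<setminus> h z)) \<in> Dis" using step h assms by (intro Dis.step) (auto simp: closed)
  moreover have "\<forall>z\<in>B. e \<cdot> (x \<cdot> (y \<setminus>\<setminus> g z)) = (e \<cdot> x) \<cdot> ((e \<cdot> y) \<setminus>\<setminus> h (e \<cdot> z))"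
  proof
    fix z assume z: "z \<in> B"
    have gz: "g z \<in> B" using z step Dis_closed by auto
    have "e \<cdot> (x \<cdot> (y \<setminus>\<setminus> g z)) = (e \<cdot> x) \<cdot> (e \<cdot> (y \<setminus>\<setminus> g z))"
      using step assms gz by (intro distrib closed)
    also have "e \<cdot> (y \<setminus>\<setminus> g z) = (e \<cdot> y) \<setminus>\<setminus> (e \<cdot> g z)"
      using step assms gz by (intro mult_div_distrib)
    finally show "e \<cdot> (x \<cdot> (y \<setminus>\<setminus> g z)) = (e \<cdot> x) \<cdot> ((e \<cdot> y) \<setminus>\<setminus> h (e \<cdot> z))"
      by (simp only: h(2)[OF z])
  qed
  ultimately show ?case by - (rule bexI[rotated], assumption+)
qed (auto intro: Dis.id)

lemma Dis_conjugate_inverse: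
  assumes "e \<in> B"
  shows "g \<in> Dis \<Longrightarrow> \<exists>h\<in>Dis. \<forall>z\<in>B. e \<setminus>\<setminus> g z = h (e \<setminus>\<setminus> z)"
proof (induction rule: Dis.induct)
  case (step g x y)
  then obtain h where h: "h \<in> Dis" "\<And>z. z \<in> B \<Longrightarrow> e \<setminus>\<setminus> g z = h (e \<setminus>\<setminus> z)" by blast
  have "(\<lambda>z. (e \<setminus>\<setminus> x) \<cdot> ((e \<setminus>\<setminus> y) \<setminus>\<setminus> h z)) \<in> Dis" using step h assms by (intro Dis.step) (auto simp: closed)
  moreover have "\<forall>z\<in>B. e \<setminus>\<setminus> (x \<cdot> (y \<setminus>\<setminus> g z)) = (e \<setminus>\<setminus> x) \<cdot> ((e \<setminus>\<setminus> y) \<setminus>\<setminus> h (e \<setminus>\<setminus> z))"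
  proof
    fix z assume z: "z \<in> B"
    have gz: "g z \<in> B" using z step Dis_closed by auto
    have "e \<setminus>\<setminus> (x \<cdot> (y \<setminus>\<setminus> g z)) = (e \<setminus>\<setminus> x) \<cdot> (e \<setminus>\<setminus> (y \<setminus>\<setminus> g z))"
      using step assms gz by (intro div_distrib closed)
    also have "e \<setminus>\<setminus> (y \<setminus>\<setminus> g z) = (e \<setminus>\<setminus> y) \<setminus>\<setminus> (e \<setminus>\<setminus> g z)"
      using step assms gz by (intro div_div_distrib)
    finally show "e \<setminus>\<setminus> (x \<cdot> (y \<setminus>\<setminus> g z)) = (e \<setminus>\<setminus> x) \<cdot> ((e \<setminus>\<setminus> y) \<setminus>\<setminus> h (e \<setminus>\<setminus> z))"
      by (simp only: h(2)[OF z])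
  qed
  ultimately show ?case by - (rule bexI[rotated], assumption+)
qed (auto intro: Dis.id)

definition orbit :: "'q \<Rightarrow> 'q set" where
  "orbit e = {g e | g. g \<in> Dis}"

lemma orbit_refl: "e \<in> orbit e"
  unfolding orbit_def using Dis.id by fastforce

lemma orbit_subset: "e \<in> B \<Longrightarrow> orbit e \<subseteq> B"
  by (auto simp: orbit_def Dis_closed)

lemma Dis_orbit: "g \<in> Dis \<Longrightarrow> x \<in> orbit e \<Longrightarrow> g x \<in> orbit e"
proof -
  assume g: "g \<in> Dis" and "x \<in> orbit e"
  then obtain h where h: "h \<in> Dis" "x = h e" by (auto simp: orbit_def)
  with Dis_comp[OF g h(1)] show ?thesis
    unfolding orbit_def by (auto intro!: exI[of _ "\<lambda>z. g (h z)"])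
qed

text \<open>
  By idempotence \<open>x * y = L_x L_y\<^sup>-\<^sup>1 y\<close>.
\<close>
lemma mult_in_orbit_iff:
  assumes "e \<in> B" "x \<in> B" "y \<in> B"
  shows "x \<cdot> y \<in> orbit e \<longleftrightarrow> y \<in> orbit e"
proof
  have "x \<cdot> (y \<setminus>\<setminus> y) = x \<cdot> y" using assms cancel(1)[of y y] by (simp add: idem)
  thus "x \<cdot> y \<in> orbit e" if "y \<in> orbit e"
    using Dis_orbit[OF Dis.step[OF Dis.id assms(2,3)] that] by simp
  have "y \<cdot> (x \<setminus>\<setminus> (x \<cdot> y)) = y" using assms by (simp add: idem cancel)
  thus "y \<in> orbit e" if "x \<cdot> y \<in> orbit e"
    using Dis_orbit[OF Dis.step[OF Dis.id assms(3,2)] that] by simp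
qed

definition transport :: "'q \<Rightarrow> 'q \<Rightarrow> 'q \<Rightarrow> 'q" where
  "transport e x = (SOME g. g \<in> Dis \<and> g e = x)"

lemma transport:
  assumes "x \<in> orbit e"
  shows "transport e x \<in> Dis" "transport e x e = x"
proof -
  have "\<exists>g. g \<in> Dis \<and> g e = x" using assms by (auto simp: orbit_def)
  from someI_ex[OF this] show "transport e x \<in> Dis" "transport e x e = x"
    by (simp_all add: transport_def)
qed

text \<open>
  A transitive abelian permutation group is regular: a displacement is determined on the orbit by the
  image of \<open>e\<close>.
\<close>
lemma transport_unique:
  assumes "e \<in> B" "g \<in> Dis" "z \<in> orbit e"
  shows "transport e (g e) z = g z"
proof -
  from assms(3) obtain h where h: "h \<in> Dis" "z = h e" by (auto simp: orbit_def)
  have ge: "g e \<in> orbit e" using assms by (auto simp: orbit_def)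
  have "transport e (g e) z = h (transport e (g e) e)"
    unfolding h(2) by (rule Dis_commute[OF transport(1)[OF ge] h(1) assms(1)])
  also have "\<dots> = h (g e)" by (simp only: transport(2)[OF ge])
  also have "\<dots> = g z" unfolding h(2) by (rule Dis_commute[OF h(1) assms(2,1)])
  finally show ?thesis .
qed

text \<open>
  The group structure carried over from the displacement group along \<open>g \<mapsto> g e\<close>.
\<close>
definition orbit_group :: "'q \<Rightarrow> 'q monoid" where
  "orbit_group e = \<lparr>carrier = orbit e, monoid.mult = transport e, one = e\<rparr>"

lemma comm_group_orbit_group:
  assumes e: "e \<in> B"
  shows "comm_group (orbit_group e)"
proof (rule comm_groupI)
  note tr = transport(1) transport(2)
  fix x y z
  assume "x \<in> carrier (orbit_group e)" "y \<in> carrier (orbit_group e)"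
  hence x: "x \<in> orbit e" and y: "y \<in> orbit e" by (auto simp: orbit_group_def)
  show "x \<otimes>\<^bsub>orbit_group e\<^esub> y \<in> carrier (orbit_group e)"
    using Dis_orbit tr x y by (simp add: orbit_group_def)
  have "transport e x (transport e y e) = transport e y (transport e x e)"
    using e x y by (intro Dis_commute tr)
  thus "x \<otimes>\<^bsub>orbit_group e\<^esub> y = y \<otimes>\<^bsub>orbit_group e\<^esub> x"
    using tr x y by (simp add: orbit_group_def)
  assume "z \<in> carrier (orbit_group e)"
  hence z: "z \<in> orbit e" by (simp add: orbit_group_def)
  show "x \<otimes>\<^bsub>orbit_group e\<^esub> y \<otimes>\<^bsub>orbit_group e\<^esub> z = x \<otimes>\<^bsub>orbit_group e\<^esub> (y \<otimes>\<^bsub>orbit_group e\<^esub> z)"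
    using transport_unique[OF e Dis_comp[OF tr(1)[OF x] tr(1)[OF y]] z] tr(2)[OF y]
    by (simp add: orbit_group_def)
next
  show "\<one>\<^bsub>orbit_group e\<^esub> \<in> carrier (orbit_group e)" by (simp add: orbit_group_def orbit_refl)
next
  fix x assume "x \<in> carrier (orbit_group e)"
  hence x: "x \<in> orbit e" by (simp add: orbit_group_def)
  show "\<one>\<^bsub>orbit_group e\<^esub> \<otimes>\<^bsub>orbit_group e\<^esub> x = x"
    using transport_unique[OF e Dis.id x] by (simp add: orbit_group_def)
  obtain h where h: "h \<in> Dis" "\<forall>z\<in>B. h (transport e x z) = z"
    using Dis_inverse[OF transport(1)[OF x]] by blast
  have "transport e (h e) x = e"
    using transport_unique[OF e h(1) x] h(2) e transport(2)[OF x] by metis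
  moreover have "h e \<in> orbit e" using h by (auto simp: orbit_def)
  ultimately show "\<exists>y\<in>carrier (orbit_group e). y \<otimes>\<^bsub>orbit_group e\<^esub> x = \<one>\<^bsub>orbit_group e\<^esub>"
    by (auto simp: orbit_group_def)
qed

lemma translation_auto:
  assumes e: "e \<in> B"
  shows "(\<lambda>z\<in>orbit e. e \<cdot> z) \<in> auto (orbit_group e)"
proof -
  have OB: "z \<in> B" if "z \<in> orbit e" for z using that orbit_subset[OF e] by auto
  have closed_O: "e \<cdot> z \<in> orbit e" if "z \<in> orbit e" for z
    using mult_in_orbit_iff[OF e e OB[OF that]] that by simp
  have "e \<cdot> transport e x y = transport e (e \<cdot> x) (e \<cdot> y)" if x: "x \<in> orbit e" and y: "y \<in> orbit e" for x y
  proof -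
    obtain h where h: "h \<in> Dis" "\<And>z. z \<in> B \<Longrightarrow> e \<cdot> transport e x z = h (e \<cdot> z)"
      using Dis_conjugate[OF e transport(1)[OF x]] by blast
    have "h e = e \<cdot> x" using h(2)[OF e] transport(2)[OF x] by (simp add: idem e)
    thus ?thesis using transport_unique[OF e h(1) closed_O[OF y]] h(2)[OF OB[OF y]] by simp
  qed
  hence "(\<lambda>z\<in>orbit e. e \<cdot> z) \<in> hom (orbit_group e) (orbit_group e)"
    using closed_O transport(1) Dis_orbit by (intro homI) (auto simp: orbit_group_def)
  moreover have "bij_betw (\<lambda>z\<in>orbit e. e \<cdot> z) (orbit e) (orbit e)"
  proof (rule bij_betwI[where g = "\<lambda>z. e \<setminus>\<setminus> z"])
    show "(\<lambda>z. e \<setminus>\<setminus> z) \<in> orbit e \<rightarrow> orbit e"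
    proof
      fix z assume "z \<in> orbit e"
      then obtain g where g: "g \<in> Dis" "z = g e" by (auto simp: orbit_def)
      then obtain h where "h \<in> Dis" "e \<setminus>\<setminus> g e = h (e \<setminus>\<setminus> e)"
        using Dis_conjugate_inverse[OF e] e by blast
      moreover have "e \<setminus>\<setminus> e = e" using cancel(1)[OF e e] by (simp add: idem e)
      ultimately show "e \<setminus>\<setminus> z \<in> orbit e" using g by (auto simp: orbit_def)
    qed
    thus "(\<lambda>z\<in>orbit e. e \<cdot> z) (e \<setminus>\<setminus> z) = z" if "z \<in> orbit e" for z
      using that OB e by (auto simp: cancel)
  qed (use closed_O OB e cancel in auto)
  ultimately show ?thesis by (simp add: auto_def Bij_def orbit_group_def)
qed

text \<open>
  With \<open>g\<close> the displacement taking \<open>e\<close> to \<open>x\<close> and \<open>w = y - x\<close>, so that \<open>y = g w\<close>, the product is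
  \<open>g e * g w = g (e * w)\<close>.
\<close>
lemma mult_eq_orbit_group:
  assumes e: "e \<in> B" and x: "x \<in> orbit e" and y: "y \<in> orbit e"
  shows "x \<cdot> y = x \<otimes>\<^bsub>orbit_group e\<^esub>
    ((\<lambda>z\<in>orbit e. e \<cdot> z) (inv\<^bsub>orbit_group e\<^esub> x \<otimes>\<^bsub>orbit_group e\<^esub> y))"
proof -
  interpret G: comm_group "orbit_group e" by (rule comm_group_orbit_group[OF e])
  have car: "carrier (orbit_group e) = orbit e" by (simp add: orbit_group_def)
  define w where "w = inv\<^bsub>orbit_group e\<^esub> x \<otimes>\<^bsub>orbit_group e\<^esub> y"
  have w: "w \<in> orbit e" unfolding w_def using G.m_closed[of "inv\<^bsub>orbit_group e\<^esub> x" y] G.inv_closed[of x] x y by (simp add: car)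
  have "y = x \<otimes>\<^bsub>orbit_group e\<^esub> w"
    unfolding w_def using x y G.m_assoc[of x "inv\<^bsub>orbit_group e\<^esub> x" y] G.inv_closed[of x] by (simp add: car)
  hence "y = transport e x w" by (simp add: orbit_group_def)
  hence "x \<cdot> y = transport e x e \<cdot> transport e x w" using transport(2)[OF x] by simp
  also have "\<dots> = transport e x (e \<cdot> w)"
    using Dis_hom[OF transport(1)[OF x] e, of w] orbit_subset[OF e] w by auto
  finally show ?thesis using w by (simp add: w_def orbit_group_def)
qed

end

text \<open>
  Linear colorings are used twice: with \<open>t\<close> acting trivially on \<open>\<int>\<close> to see that all colors lie in one
  orbit of displacements, then with the group structure of that orbit.
\<close>
lemma (in link) medial_coloring_constant:
  assumes \<Delta>: "is_alexander_polynomial D \<Delta>" "eq_up_to_unit \<Delta> 1"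
    and "medial_quandle Q B"
    and c: "\<And>a. a \<in> arcs D \<Longrightarrow> c a \<in> B" and coloring: "coloring D Q c"
    and arcs: "a \<in> arcs D" "b \<in> arcs D"
  shows "c a = c b"
proof -
  interpret medial_quandle Q B by fact
  have rel: "c (left_arc D x) = lmult Q (c (over_arc D x)) (c (right_arc D x))" if "x \<in> crossings D" for x
    using coloring that by (simp add: coloring_def)
  define e where "e = c a"
  have e: "e \<in> B" using c arcs by (simp add: e_def)
  \<comment> \<open>The indicator function of the orbit takes the same value on both under-arcs of a crossing.\<close>
  have in_orbit: "c d \<in> orbit e" if "d \<in> arcs D" for d
  proof -
    define v :: "'e set \<Rightarrow> int" where "v d = of_bool (c d \<in> orbit e)" for d
    interpret Z: group integer_group by simp
    have "v a = v d"
    proof (rule module_coloring_constant[OF \<Delta>, where G = integer_group and \<tau> = "\<lambda>x\<in>UNIV. x"])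
      show "comm_group integer_group" by (rule Z.group_comm_groupI) simp
      show "(\<lambda>x\<in>UNIV. x) \<in> auto integer_group" using Z.id_in_auto by simp
      fix x assume x: "x \<in> crossings D"
      have "v (left_arc D x) = v (right_arc D x)"
        using mult_in_orbit_iff[OF e] c crossing_arcs[OF x] by (simp add: v_def rel[OF x])
      thus "v (left_arc D x) = v (over_arc D x) \<otimes>\<^bsub>integer_group\<^esub>
        (\<lambda>x\<in>UNIV. x) (inv\<^bsub>integer_group\<^esub> v (over_arc D x) \<otimes>\<^bsub>integer_group\<^esub> v (right_arc D x))"
        by simp
    qed (use arcs that in auto)
    moreover have "v a = 1" by (simp add: v_def e_def orbit_refl)
    ultimately show ?thesis by (simp add: v_def split: if_splits)
  qed
  show ?thesis
  proof (rule module_coloring_constant[OF \<Delta> comm_group_orbit_group[OF e] translation_auto[OF e]])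
    show "c d \<in> carrier (orbit_group e)" if "d \<in> arcs D" for d
      using in_orbit[OF that] by (simp add: orbit_group_def)
    fix x assume x: "x \<in> crossings D"
    show "c (left_arc D x) = c (over_arc D x) \<otimes>\<^bsub>orbit_group e\<^esub> (\<lambda>z\<in>orbit e. lmult Q e z)
        (inv\<^bsub>orbit_group e\<^esub> c (over_arc D x) \<otimes>\<^bsub>orbit_group e\<^esub> c (right_arc D x))"
      unfolding rel[OF x] by (rule mult_eq_orbit_group[OF e]) (use in_orbit crossing_arcs[OF x] in auto)
  qed (use arcs in auto)
qed

section \<open>Solvable quandles\<close>

text \<open>
  Let \<open>h = L_u L_v\<^sup>-\<^sup>1\<close>, an automorphism. It commutes with \<open>L_x L_y\<^sup>-\<^sup>1\<close> iff
  \<open>L_x\<^sup>-\<^sup>1 L_(h x) = L_y\<^sup>-\<^sup>1 L_(h y)\<close>, because \<open>h L_x h\<^sup>-\<^sup>1 = L_(h x)\<close>. So the value at \<open>w\<close> of \<open>L_z\<^sup>-\<^sup>1 L_(h z)\<close>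
  should not depend on \<open>z\<close>. It is the value of a term \<open>T z u v w\<close>, and it is clearly independent of \<open>z\<close> for
  \<open>u = v\<close>. The term condition transfers this to all \<open>u\<close> and \<open>v\<close>.
\<close>
lemma abelian_block_medial:
  assumes Q: "is_quandle Q" and ab: "abelian_congruence Q \<gamma>" and e: "e \<in> carrier Q"
  shows "medial_quandle Q (\<gamma> `` {e})"
proof -
  have cong: "congruence Q \<gamma>" and cent: "centralizes Q \<gamma> \<gamma> (Id_on (carrier Q))"
    using ab by (auto simp: abelian_congruence_def)
  have eq: "equiv (carrier Q) \<gamma>" using cong by (simp add: congruence_def)
  have sub: "x \<in> carrier Q" if "x \<in> \<gamma> `` {e}" for x
    using that eq by (auto simp: equiv_def)
  have rel: "(x, y) \<in> \<gamma>" if "x \<in> \<gamma> `` {e}" "y \<in> \<gamma> `` {e}" for x y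
    using that eq by (meson Image_singleton_iff equivE symD transD)
  have lq: "lmult Q x y \<in> carrier Q" "ldiv Q x y \<in> carrier Q" "ldiv Q x (lmult Q x y) = y"
    "lmult Q x (ldiv Q x y) = y" "lmult Q x x = x" if "x \<in> carrier Q" "y \<in> carrier Q" for x y
    using Q that by (auto simp: is_quandle_def is_left_quasigroup_def)
  have dist: "lmult Q x (lmult Q y z) = lmult Q (lmult Q x y) (lmult Q x z)"
    if "x \<in> carrier Q" "y \<in> carrier Q" "z \<in> carrier Q" for x y z
    using Q that by (simp add: is_quandle_def)
  have "ldiv Q e e = e" using lq[OF e e] by metis
  hence cl: "lmult Q x y \<in> \<gamma> `` {e}" "ldiv Q x y \<in> \<gamma> `` {e}" if "x \<in> \<gamma> `` {e}" "y \<in> \<gamma> `` {e}" for x y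
    using that cong lq(5)[OF e e] unfolding congruence_def by (fastforce+)
  define T where "T z u v w = ldiv Q z (lmult Q (lmult Q u (ldiv Q v z)) w)" for z u v w
  have T_const: "T x u v w = T y u v w"
    if B: "x \<in> \<gamma> `` {e}" "y \<in> \<gamma> `` {e}" "u \<in> \<gamma> `` {e}" "v \<in> \<gamma> `` {e}" "w \<in> \<gamma> `` {e}" for x y u v w
  proof -
    \<comment> \<open>\<open>T z e e\<close> is the identity, so parameters with the same value of the term at \<open>x\<close> are at hand.\<close>
    define w' where "w' = T x u v w"
    have w': "w' \<in> \<gamma> `` {e}" unfolding w'_def T_def using B by (intro cl)
    have T_e: "T z e e w' = w'" if "z \<in> carrier Q" for z
      using that e lq[OF e that] lq[OF that sub[OF w']] by (simp add: T_def)
    let ?t = "Div (Var 0) (Mult (Mult (Var 1) (Div (Var 2) (Var 0))) (Var 3))"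
    let ?p = "\<lambda>i. [u, v, w] ! i" and ?q = "\<lambda>i. [e, e, w'] ! i"
    have t: "term_op Q ?t (case_nat z f) = T z (f 0) (f 1) (f 2)" for z f
      by (simp add: T_def eval_nat_numeral)
    have e_B: "e \<in> \<gamma> `` {e}" using eq e by (auto simp: equiv_def refl_on_def)
    have "(?p i, ?q i) \<in> \<gamma>" if "i < 3" for i
      using that B w' e_B rel by (auto simp: less_Suc_eq numeral_3_eq_3)
    moreover have "(term_op Q ?t (case_nat x ?p), term_op Q ?t (case_nat x ?q)) \<in> Id_on (carrier Q)"
      unfolding t using T_e[OF sub[OF B(1)]] sub[OF w'] by (auto simp: eval_nat_numeral simp flip: w'_def)
    moreover have "term_vars ?t \<subseteq> {..3}" by simp
    ultimately have "(term_op Q ?t (case_nat y ?p), term_op Q ?t (case_nat y ?q)) \<in> Id_on (carrier Q)"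
      using cent[unfolded centralizes_def, rule_format, of ?t 3 x y ?p ?q] rel[OF B(1,2)] by simp
    hence "T y u v w = T y e e w'" unfolding t by (auto simp: eval_nat_numeral)
    thus ?thesis using T_e[OF sub[OF B(2)]] by (simp add: w'_def)
  qed
  show ?thesis
  proof
    fix x y u v w
    assume B: "x \<in> \<gamma> `` {e}" "y \<in> \<gamma> `` {e}" "u \<in> \<gamma> `` {e}" "v \<in> \<gamma> `` {e}" "w \<in> \<gamma> `` {e}"
    let ?h = "\<lambda>z. lmult Q u (ldiv Q v z)"
    have h_closed: "?h z \<in> carrier Q" if "z \<in> carrier Q" for z using that B sub lq by simp
    have h_mult: "?h (lmult Q z p) = lmult Q (?h z) (?h p)" if z: "z \<in> carrier Q" and p: "p \<in> carrier Q" for z p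
    proof -
      have v: "v \<in> carrier Q" and u: "u \<in> carrier Q" using B sub by auto
      have "lmult Q v (lmult Q (ldiv Q v z) (ldiv Q v p)) = lmult Q z p"
        using dist[OF v lq(2)[OF v z] lq(2)[OF v p]] lq[OF v z] lq[OF v p] by simp
      hence "ldiv Q v (lmult Q z p) = lmult Q (ldiv Q v z) (ldiv Q v p)"
        using lq(3)[OF v lq(1)[OF lq(2)[OF v z] lq(2)[OF v p]]] by simp
      thus ?thesis using dist[OF u lq(2)[OF v z] lq(2)[OF v p]] by simp
    qed
    have x: "x \<in> carrier Q" and y: "y \<in> carrier Q" and w: "w \<in> carrier Q" using B sub by auto
    define p where "p = ldiv Q y w"
    have p: "p \<in> \<gamma> `` {e}" unfolding p_def using B by (intro cl)
    have hp: "?h p \<in> \<gamma> `` {e}" using B p by (intro cl)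
    have expand: "lmult Q z (T z u v q) = lmult Q (?h z) q" if "z \<in> carrier Q" "q \<in> carrier Q" for z q
      unfolding T_def using that h_closed lq(1,4) by simp
    have "?h (lmult Q x p) = lmult Q x (T x u v (?h p))"
      using expand[OF x sub[OF hp]] h_mult[OF x sub[OF p]] by simp
    also have "\<dots> = lmult Q x (T y u v (?h p))" using T_const[of x y u v "?h p"] B hp by simp
    also have "T y u v (?h p) = ldiv Q y (?h (lmult Q y p))"
      unfolding T_def using h_mult[OF y sub[OF p]] by simp
    also have "lmult Q y p = w" unfolding p_def using lq[OF y w] by simp
    finally show "lmult Q x (ldiv Q y (lmult Q u (ldiv Q v w))) = lmult Q u (ldiv Q v (lmult Q x (ldiv Q y w)))"
      by (simp add: p_def)
  next
    fix x y z assume "x \<in> \<gamma> `` {e}" "y \<in> \<gamma> `` {e}" "z \<in> \<gamma> `` {e}"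
    thus "lmult Q x (lmult Q y z) = lmult Q (lmult Q x y) (lmult Q x z)"
      by (intro dist sub)
  next
    fix x assume "x \<in> \<gamma> `` {e}"
    from lq(5)[OF sub[OF this] sub[OF this]] show "lmult Q x x = x" .
  next
    fix x y assume "x \<in> \<gamma> `` {e}" "y \<in> \<gamma> `` {e}"
    from lq(3,4)[OF this[THEN sub]] show "ldiv Q x (lmult Q x y) = y" "lmult Q x (ldiv Q x y) = y" .
  qed (fact cl)+
qed

lemma quotient_op:
  assumes "congruence Q \<alpha>" "x \<in> carrier Q" "y \<in> carrier Q"
  shows "lmult (quotient_algebra Q \<alpha>) (\<alpha> `` {x}) (\<alpha> `` {y}) = \<alpha> `` {lmult Q x y}"
    "ldiv (quotient_algebra Q \<alpha>) (\<alpha> `` {x}) (\<alpha> `` {y}) = \<alpha> `` {ldiv Q x y}"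
proof -
  have eq: "equiv (carrier Q) \<alpha>" using assms(1) by (simp add: congruence_def)
  have resp: "(\<lambda>x y. \<alpha> `` {lmult Q x y}) respects2 \<alpha>" "(\<lambda>x y. \<alpha> `` {ldiv Q x y}) respects2 \<alpha>"
    using assms(1) unfolding congruent2_def congruence_def
    by (fastforce intro!: equiv_class_eq[OF eq])+
  show "lmult (quotient_algebra Q \<alpha>) (\<alpha> `` {x}) (\<alpha> `` {y}) = \<alpha> `` {lmult Q x y}"
    "ldiv (quotient_algebra Q \<alpha>) (\<alpha> `` {x}) (\<alpha> `` {y}) = \<alpha> `` {ldiv Q x y}"
    unfolding quotient_algebra_def using UN_equiv_class2[OF eq eq resp(1) assms(2,3)]
      UN_equiv_class2[OF eq eq resp(2) assms(2,3)] by simp_all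
qed

lemma quotient_quandle:
  assumes Q: "is_quandle Q" and \<alpha>: "congruence Q \<alpha>"
  shows "is_quandle (quotient_algebra Q \<alpha>)"
proof -
  let ?A = "quotient_algebra Q \<alpha>"
  have car: "carrier ?A = (\<lambda>x. \<alpha> `` {x}) ` carrier Q"
    by (auto simp: quotient_algebra_def quotient_def)
  have lq: "lmult Q x y \<in> carrier Q" "ldiv Q x y \<in> carrier Q" "ldiv Q x (lmult Q x y) = y"
    "lmult Q x (ldiv Q x y) = y" "lmult Q x x = x" if "x \<in> carrier Q" "y \<in> carrier Q" for x y
    using Q that by (auto simp: is_quandle_def is_left_quasigroup_def)
  have "carrier Q \<noteq> {}" using Q by (simp add: is_quandle_def is_left_quasigroup_def)
  moreover have "lmult ?A X (lmult ?A Y Z) = lmult ?A (lmult ?A X Y) (lmult ?A X Z)"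
    if XYZ: "X \<in> carrier ?A" "Y \<in> carrier ?A" "Z \<in> carrier ?A" for X Y Z
  proof -
    obtain x y z where X: "x \<in> carrier Q" "X = \<alpha> `` {x}" and Y: "y \<in> carrier Q" "Y = \<alpha> `` {y}"
      and Z: "z \<in> carrier Q" "Z = \<alpha> `` {z}" using XYZ unfolding car by blast
    have "lmult Q x (lmult Q y z) = lmult Q (lmult Q x y) (lmult Q x z)"
      using Q X Y Z by (simp add: is_quandle_def)
    thus ?thesis by (simp only: X Y Z quotient_op[OF \<alpha>] lq(1))
  qed
  ultimately show ?thesis
    unfolding is_quandle_def is_left_quasigroup_def
    by (auto simp: car quotient_op[OF \<alpha>] lq)
qed

lemma (in link) colors_congruent_step:
  assumes \<Delta>: "is_alexander_polynomial D \<Delta>" "eq_up_to_unit \<Delta> 1"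
    and Q: "is_quandle Q" and \<alpha>: "congruence Q \<alpha>"
    and ab: "abelian_congruence (quotient_algebra Q \<alpha>) (quotient_congruence \<beta> \<alpha>)"
    and c: "coloring D Q c" and \<beta>: "\<And>a b. a \<in> arcs D \<Longrightarrow> b \<in> arcs D \<Longrightarrow> (c a, c b) \<in> \<beta>"
    and arcs: "a \<in> arcs D" "b \<in> arcs D"
  shows "(c a, c b) \<in> \<alpha>"
proof -
  let ?A = "quotient_algebra Q \<alpha>" and ?\<gamma> = "quotient_congruence \<beta> \<alpha>"
  let ?c = "\<lambda>d. \<alpha> `` {c d}"
  have cQ: "c d \<in> carrier Q" if "d \<in> arcs D" for d using c that by (auto simp: coloring_def)
  have cA: "?c d \<in> carrier ?A" if "d \<in> arcs D" for d
    using cQ[OF that] by (auto simp: quotient_algebra_def quotient_def)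
  have "?c a = ?c b"
  proof (rule medial_coloring_constant[OF \<Delta> abelian_block_medial[OF quotient_quandle[OF Q \<alpha>] ab cA[OF arcs(1)]] _ _ arcs])
    show "?c d \<in> ?\<gamma> `` {?c a}" if "d \<in> arcs D" for d
      using \<beta>[OF arcs(1) that] by (auto simp: quotient_congruence_def)
    show "coloring D ?A ?c"
      unfolding coloring_def
    proof (intro conjI ballI)
      show "?c ` arcs D \<subseteq> carrier ?A" using cA by auto
      fix x assume x: "x \<in> crossings D"
      have "lmult Q (c (over_arc D x)) (c (right_arc D x)) = c (left_arc D x)"
        using c x by (simp add: coloring_def)
      thus "lmult ?A (?c (over_arc D x)) (?c (right_arc D x)) = ?c (left_arc D x)"
        using quotient_op(1)[OF \<alpha>] cQ crossing_arcs[OF x] by simp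
    qed
  qed
  thus ?thesis
    using eq_equiv_class[of \<alpha> "c a" "c b"] \<alpha> cQ[OF arcs(2)] by (auto simp: congruence_def)
qed

theorem theorem8p4:
  fixes L :: "'e diagram" and \<Delta> :: laurent and Q :: "'q left_quasigroup"
  assumes "link_diagram L"
    and "is_alexander_polynomial L \<Delta>" and "eq_up_to_unit \<Delta> 1"
    and "is_quandle Q" and "finite (carrier Q)" and "connected_left_quasigroup Q" and "solvable_algebra Q"
  shows "\<not> colorable L Q"
proof
  interpret link L by unfold_locales fact
  assume "colorable L Q"
  then obtain c where c: "coloring L Q c" and nontrivial: "\<not> trivial_coloring L c"
    by (auto simp: colorable_def)
  obtain n :: nat and \<alpha> where \<alpha>_0: "\<alpha> 0 = Id_on (carrier Q)" and \<alpha>_n: "\<alpha> n = carrier Q \<times> carrier Q"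
    and cong: "\<And>i. i \<le> n \<Longrightarrow> congruence Q (\<alpha> i)"
    and ab: "\<And>i. i < n \<Longrightarrow> abelian_congruence (quotient_algebra Q (\<alpha> i)) (quotient_congruence (\<alpha> (Suc i)) (\<alpha> i))"
    using assms(7) unfolding solvable_algebra_def by blast
  have "\<forall>a\<in>arcs L. \<forall>b\<in>arcs L. (c a, c b) \<in> \<alpha> 0"
  proof (rule inc_induct[of 0 n])
    show "\<forall>a\<in>arcs L. \<forall>b\<in>arcs L. (c a, c b) \<in> \<alpha> n"
      using c unfolding coloring_def \<alpha>_n by auto
    fix i assume i: "i < n" and IH: "\<forall>a\<in>arcs L. \<forall>b\<in>arcs L. (c a, c b) \<in> \<alpha> (Suc i)"
    show "\<forall>a\<in>arcs L. \<forall>b\<in>arcs L. (c a, c b) \<in> \<alpha> i"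
      using colors_congruent_step[OF assms(2,3,4) cong ab c] i IH by simp
  qed simp
  hence "c a = c b" if "a \<in> arcs L" "b \<in> arcs L" for a b using that by (auto simp: \<alpha>_0)
  hence "trivial_coloring L c" unfolding trivial_coloring_def by blast
  with nontrivial show False by contradiction
qed

end
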